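(* Let $G$ be a discrete convergence group acting on a compact metrizable space $M$, and suppose that the action is non-elementary and minimal. Then there exists a compact topology on the disjoint union $G\cup M$ such that the inclusions $G\hookrightarrow G\cup M$ (with $G$ discrete) and $M\hookrightarrow G\cup M$ are topological embeddings, and such that for any generating probability measure $\mu$ on $G$, almost every sample path $(w_n)$ of the associated random walk on $G$ converges in $G\cup M$ to a point in $M$.
   Context: A convergence group on $M$ is a countable (discrete) group $G$ acting by homeomorphisms on the compact metrizable space $M$ such that for every infinite sequence $(g_n)\subset G$ of distinct elements there exist a subsequence $(g_{n_k})$ and points $a,b\in M$ such that $g_{n_k}|_{M\setminus\{a\}}$ converges to $b$ locally uniformly, i.e. for every compact $K\subset M\setminus\{a\}$ and every neighbourhood $U$ of $b$ there is $N$ with $g_{n_k}(K)\subset U$ whenever $n_k>N$. The action is non-elementary if there is no invariant subset of $M$ consisting of 1 or 2 points. It is minimal if $M$ has no proper (nonempty) closed invariant subset. A probability measure $\mu$ on $G$ is generating if its support generates $G$. The random walk associated with $\mu$ is $w_n=g_1g_2\cdots g_n$, where the $g_i$ are independent $G$-valued random variables with distribution $\mu$ (started at the identity). *)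

theory Defs
  imports
    "HOL-Analysis.Analysis"
    "HOL-Probability.Probability"
    "HOL-Algebra.Group_Action"
    "HOL-Algebra.Generated_Groups"
begin

text \<open>
  The space \<open>M\<close> is an abstract topology \<open>X\<close>, and \<open>G\<close> acts from the left through
  \<open>\<phi>\<close>. \<^const>\<open>group_action\<close> only asks for bijections of the set
  \<^term>\<open>topspace X\<close>, so that they are homeomorphisms is a separate assumption.
\<close>

locale convergence_group =
  group_action G "topspace X" \<phi>
  for G :: "('g, 'b) monoid_scheme" (structure)
    and X :: "'m topology"
    and \<phi> :: "'g \<Rightarrow> 'm \<Rightarrow> 'm" +
  assumes countable_group: "countable (carrier G)"
    and compact_space: "compact_space X"
    and metrizable_space: "metrizable_space X"
    and homeomorphic_action: "\<And>g. g \<in> carrier G \<Longrightarrow> homeomorphic_map X X (\<phi> g)"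
    and convergence_property:
      "\<And>s :: nat \<Rightarrow> 'g. inj s \<Longrightarrow> range s \<subseteq> carrier G \<Longrightarrow>
        \<exists>r a b. strict_mono r \<and> a \<in> topspace X \<and> b \<in> topspace X \<and>
          (\<forall>K U. compactin X K \<and> K \<subseteq> topspace X - {a} \<and> openin X U \<and> b \<in> U \<longrightarrow>
             (\<forall>\<^sub>F k in sequentially. \<phi> (s (r k)) ` K \<subseteq> U))"

definition invariant_subset ::
  "('g, 'b) monoid_scheme \<Rightarrow> 'm topology \<Rightarrow> ('g \<Rightarrow> 'm \<Rightarrow> 'm) \<Rightarrow> 'm set \<Rightarrow> bool" where
  "invariant_subset G X \<phi> A \<longleftrightarrow> A \<subseteq> topspace X \<and> (\<forall>g\<in>carrier G. \<phi> g ` A = A)"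

definition non_elementary ::
  "('g, 'b) monoid_scheme \<Rightarrow> 'm topology \<Rightarrow> ('g \<Rightarrow> 'm \<Rightarrow> 'm) \<Rightarrow> bool" where
  "non_elementary G X \<phi> \<longleftrightarrow>
     \<not> (\<exists>A. invariant_subset G X \<phi> A \<and> (card A = 1 \<or> card A = 2))"

definition minimal_action ::
  "('g, 'b) monoid_scheme \<Rightarrow> 'm topology \<Rightarrow> ('g \<Rightarrow> 'm \<Rightarrow> 'm) \<Rightarrow> bool" where
  "minimal_action G X \<phi> \<longleftrightarrow>
     \<not> (\<exists>A. invariant_subset G X \<phi> A \<and> closedin X A \<and> A \<noteq> {} \<and> A \<noteq> topspace X)"

text \<open>
  Since \<open>G\<close> is countable and discrete, its probability measures are the mass functions
  supported in the carrier. The support is required to generate \<open>G\<close> as a group (not as a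
  semigroup), which is the weaker condition.
\<close>

definition generating_pmf :: "('g, 'b) monoid_scheme \<Rightarrow> 'g pmf \<Rightarrow> bool" where
  "generating_pmf G \<mu> \<longleftrightarrow>
     set_pmf \<mu> \<subseteq> carrier G \<and> generate G (set_pmf \<mu>) = carrier G"

definition increments :: "'g pmf \<Rightarrow> (nat \<Rightarrow> 'g) measure" where
  "increments \<mu> = Pi\<^sub>M UNIV (\<lambda>_. measure_pmf \<mu>)"

text \<open>
  With increments indexed from \<open>0\<close>, \<open>random_walk G \<omega> n\<close> is
  \<open>\<omega> 0 \<otimes> \<dots> \<otimes> \<omega> (n - 1)\<close>; new increments are multiplied on the right.
\<close>

primrec random_walk :: "('g, 'b) monoid_scheme \<Rightarrow> (nat \<Rightarrow> 'g) \<Rightarrow> nat \<Rightarrow> 'g" where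
  "random_walk G \<omega> 0 = \<one>\<^bsub>G\<^esub>"
| "random_walk G \<omega> (Suc n) = random_walk G \<omega> n \<otimes>\<^bsub>G\<^esub> \<omega> n"

text \<open>
  A compact topology means a compact Hausdorff one; without separation the claim is
  trivial (let the open sets be the subsets of \<open>G\<close> and the sets \<open>G \<union> U\<close> with \<open>U\<close>
  open in \<open>M\<close>). The Hausdorff property is demanded for infinite \<open>G\<close> only: a finite group
  acting transitively on three or more points is formally minimal and non-elementary, but in
  a Hausdorff topology no walk on a finite \<open>G\<close> converges to a point of \<open>M\<close>.
\<close>

definition compactification_topology ::
  "('g, 'b) monoid_scheme \<Rightarrow> 'm topology \<Rightarrow> ('g + 'm) topology \<Rightarrow> bool" where
  "compactification_topology G X T \<longleftrightarrow>
     topspace T = carrier G <+> topspace X \<and>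
     compact_space T \<and>
     (infinite (carrier G) \<longrightarrow> Hausdorff_space T) \<and>
     embedding_map (discrete_topology (carrier G)) T Inl \<and>
     embedding_map X T Inr"

end

theory Submission
  imports Defs
begin

text \<open>
  If \<open>G\<close> is infinite, then so is \<open>M\<close>. Fix three points of \<open>M\<close> and let \<open>g \<in> G\<close> be close
  to \<open>x \<in> M\<close> when \<open>g\<close> maps all of them but at most one close to \<open>x\<close>; by the convergence property
  this gives a compact Hausdorff topology, in which a sequence of distinct elements with
  attracting point \<open>b\<close> converges to \<open>b\<close>.

  Let \<open>\<nu>\<close> be a \<open>\<mu>\<close>-stationary mean, that is, a finitely additive probability on all subsets of
  \<open>M\<close>. The points of maximal mass form a finite invariant set, so \<open>\<nu>\<close> has no atoms, and
  \<open>g\<^sub>n \<nu>\<close> concentrates at \<open>b\<close> whenever \<open>b\<close> is the attracting point of \<open>(g\<^sub>n)\<close>. For every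
  \<open>A \<subseteq> M\<close> the function \<open>h g = \<nu> (g\<^sup>-\<^sup>1 A)\<close> is bounded and harmonic, so \<open>h (w\<^sub>n)\<close> converges
  almost surely; with \<open>A\<close> in a countable base, this leaves only one possible attracting point
  for the subsequences of \<open>(w\<^sub>n)\<close>. The walk is transient because the expected
  sum of \<open>\<Sum>\<^sub>s \<mu>(s) (h (w\<^sub>n s) - h (w\<^sub>n))\<^sup>2\<close> over \<open>n\<close> is at most \<open>1\<close>, whereas from every
  \<open>g\<close> the walk can reach a point where this term is positive for some \<open>A\<close>.

  If \<open>G\<close> is finite, the open sets are the subsets of \<open>G\<close> and the sets \<open>G \<union> U\<close>.
\<close>

section \<open>Random iterations on a countable set\<close>

primrec iterate :: "('a \<Rightarrow> 's \<Rightarrow> 'a) \<Rightarrow> 'a \<Rightarrow> (nat \<Rightarrow> 's) \<Rightarrow> nat \<Rightarrow> 'a" where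
  "iterate f x \<omega> 0 = x"
| "iterate f x \<omega> (Suc n) = f (iterate f x \<omega> n) (\<omega> n)"

lemma iterate_case_nat: "iterate f x (case_nat s \<omega>) (Suc n) = iterate f (f x s) \<omega> n"
  by (induction n) auto

text \<open>Closedness is required for every letter \<open>s\<close>, also outside the support of
  \<open>\<mu>\<close>, so that paths surely stay in the countable set \<open>C\<close>, where
  measurability is checked value by value.\<close>

locale random_iteration =
  fixes C :: "'a set" and f :: "'a \<Rightarrow> 's \<Rightarrow> 'a" and \<mu> :: "'s pmf"
  assumes countable_states: "countable C"
    and step_closed: "x \<in> C \<Longrightarrow> f x s \<in> C"
begin

sublocale S: sequence_space "measure_pmf \<mu>"
  by unfold_locales

abbreviation path :: "'a \<Rightarrow> (nat \<Rightarrow> 's) \<Rightarrow> nat \<Rightarrow> 'a" where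
  "path \<equiv> iterate f"

definition transition :: "('a \<Rightarrow> ennreal) \<Rightarrow> 'a \<Rightarrow> ennreal" where
  "transition u x = (\<integral>\<^sup>+ s. u (f x s) \<partial>measure_pmf \<mu>)"

lemma path_in: "x \<in> C \<Longrightarrow> path x \<omega> n \<in> C"
  by (induction n) (auto simp: step_closed)

lemma measurable_path_states:
  assumes "x \<in> C"
  shows "(\<lambda>\<omega>. path x \<omega> n) \<in> S.S \<rightarrow>\<^sub>M count_space C"
proof (induction n)
  case 0
  then show ?case using assms by simp
next
  case (Suc n)
  have "(\<lambda>\<omega>. f i (\<omega> n)) \<in> S.S \<rightarrow>\<^sub>M count_space C" if "i \<in> C" for i
  proof (rule measurable_compose[where N = "measure_pmf \<mu>"])
    show "f i \<in> measure_pmf \<mu> \<rightarrow>\<^sub>M count_space C"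
      using that step_closed by simp
  qed measurable
  from measurable_compose_countable'[OF this Suc countable_states] show ?case
    by simp
qed

lemma measurable_path:
  assumes "x \<in> C"
  shows "(\<lambda>\<omega>. path x \<omega> n) \<in> S.S \<rightarrow>\<^sub>M count_space UNIV"
  using measurable_path_states[OF assms] by (rule measurable_compose) simp

text \<open>The product measure is the image of its own product with \<open>\<mu>\<close> under
  prepending a letter by \<open>case_nat\<close>. Fubini then isolates the first letter.\<close>

lemma nn_integral_first_step:
  assumes [measurable]: "F \<in> borel_measurable S.S"
  shows "(\<integral>\<^sup>+ \<omega>. F \<omega> \<partial>S.S) = (\<integral>\<^sup>+ s. \<integral>\<^sup>+ \<omega>. F (case_nat s \<omega>) \<partial>S.S \<partial>measure_pmf \<mu>)"
proof -
  have "prob_space S.S"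
    by (intro prob_space_PiM measure_pmf.prob_space_axioms)
  note fubini = sigma_finite_measure.nn_integral_fst[OF prob_space_imp_sigma_finite[OF this], symmetric]
  have "(\<integral>\<^sup>+ \<omega>. F \<omega> \<partial>S.S) =
      (\<integral>\<^sup>+ \<omega>. F \<omega> \<partial>distr (measure_pmf \<mu> \<Otimes>\<^sub>M S.S) S.S (\<lambda>(s, \<omega>). case_nat s \<omega>))"
    by (simp add: S.PiM_iter)
  also have "\<dots> = (\<integral>\<^sup>+ z. F (case_nat (fst z) (snd z)) \<partial>(measure_pmf \<mu> \<Otimes>\<^sub>M S.S))"
    by (subst nn_integral_distr) (auto simp: split_beta')
  also have "\<dots> = (\<integral>\<^sup>+ s. \<integral>\<^sup>+ \<omega>. F (case_nat s \<omega>) \<partial>S.S \<partial>measure_pmf \<mu>)"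
    by (subst fubini) (auto simp: split_beta')
  finally show ?thesis .
qed

text \<open>The Markov property: once \<open>s\<close> is prepended, the path from \<open>x\<close>
  is the path from \<open>f x s\<close> delayed by one step, so each step contributes one
  application of \<open>transition\<close>.\<close>

lemma nn_integral_path:
  assumes "x \<in> C"
  shows "(\<integral>\<^sup>+ \<omega>. u (path x \<omega> n) \<partial>S.S) = (transition ^^ n) u x"
  using assms
proof (induction n arbitrary: x)
  case 0
  then show ?case by (simp add: S.emeasure_space_1)
next
  case (Suc n)
  have "(\<lambda>\<omega>. u (path x \<omega> (Suc n))) \<in> borel_measurable S.S"
    by (rule measurable_compose[OF measurable_path[OF Suc.prems]]) simp
  then have "(\<integral>\<^sup>+ \<omega>. u (path x \<omega> (Suc n)) \<partial>S.S) =
      (\<integral>\<^sup>+ s. \<integral>\<^sup>+ \<omega>. u (path x (case_nat s \<omega>) (Suc n)) \<partial>S.S \<partial>measure_pmf \<mu>)"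
    by (rule nn_integral_first_step)
  also have "\<dots> = (\<integral>\<^sup>+ s. (transition ^^ n) u (f x s) \<partial>measure_pmf \<mu>)"
    by (simp only: iterate_case_nat Suc.IH[OF step_closed[OF Suc.prems]])
  finally show ?case
    by (simp add: transition_def[of "(transition ^^ n) u"])
qed

lemma emeasure_first_step:
  assumes "A \<in> sets S.S"
  shows "emeasure S.S A = (\<integral>\<^sup>+ s. emeasure S.S {\<omega>. case_nat s \<omega> \<in> A} \<partial>measure_pmf \<mu>)"
proof -
  have sp: "space S.S = UNIV"
    by (simp add: space_PiM PiE_UNIV_domain)
  have "{\<omega>. case_nat s \<omega> \<in> A} \<in> sets S.S" for s
  proof -
    have "(\<lambda>\<omega>. case_nat s \<omega>) \<in> S.S \<rightarrow>\<^sub>M S.S"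
      by measurable
    from measurable_sets[OF this assms] show ?thesis
      by (simp add: vimage_def sp)
  qed
  moreover have "indicator A (case_nat s \<omega>) = (indicator {\<omega>. case_nat s \<omega> \<in> A} \<omega> :: ennreal)" for s \<omega>
    by (simp add: indicator_def)
  ultimately show ?thesis
    using nn_integral_first_step[of "indicator A"] assms by simp
qed

text \<open>By \<open>nn_integral_path\<close> the series is the expected number of visits to
  \<open>y\<close>, and a nonnegative variable of finite expectation is almost surely
  finite.\<close>

lemma AE_finitely_many_visits:
  assumes x: "x \<in> C" and fin: "(\<Sum>n. (transition ^^ n) (indicator {y}) x) < \<infinity>"
  shows "AE \<omega> in S.S. finite {n. path x \<omega> n = y}"
proof -
  have meas: "(\<lambda>\<omega>. indicator {y} (path x \<omega> n) :: ennreal) \<in> borel_measurable S.S" for n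
    by (rule measurable_compose[OF measurable_path[OF x]]) simp
  have "(\<integral>\<^sup>+ \<omega>. (\<Sum>n. indicator {y} (path x \<omega> n)) \<partial>S.S) < \<infinity>"
    using fin by (subst nn_integral_suminf[OF meas]) (simp add: nn_integral_path[OF x])
  then have "AE \<omega> in S.S. (\<Sum>n. indicator {y} (path x \<omega> n) :: ennreal) \<noteq> \<infinity>"
    by (intro nn_integral_PInf_AE borel_measurable_suminf_order meas) auto
  then show ?thesis
  proof eventually_elim
    case (elim \<omega>)
    let ?A = "{n. path x \<omega> n = y}"
    have "emeasure (count_space UNIV) ?A = (\<integral>\<^sup>+ n. indicator ?A n \<partial>count_space UNIV)"
      by simp
    also have "\<dots> = (\<Sum>n. indicator ?A n)"
      by (rule nn_integral_count_space_nat)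
    also have "\<dots> = (\<Sum>n. indicator {y} (path x \<omega> n))"
      by (simp add: indicator_def)
    finally show "finite ?A"
      using elim by (simp add: emeasure_count_space split: if_splits)
  qed
qed

text \<open>Optional stopping for a supersolution, by induction on the time of the first visit to \<open>B\<close>.\<close>

lemma emeasure_le_supersolution:
  fixes E :: "'a \<Rightarrow> (nat \<Rightarrow> 's) set"
  assumes sets: "\<And>x. x \<in> C \<Longrightarrow> E x \<in> sets S.S"
    and shift: "\<And>x s \<omega>. x \<in> C \<Longrightarrow> case_nat s \<omega> \<in> E x \<longleftrightarrow> \<omega> \<in> E (f x s)"
    and visit: "\<And>x \<omega>. x \<in> C \<Longrightarrow> \<omega> \<in> E x \<Longrightarrow> \<exists>n. path x \<omega> n \<in> B"
    and inside: "\<And>x. x \<in> C \<Longrightarrow> x \<in> B \<Longrightarrow> emeasure S.S (E x) \<le> u x"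
    and outside: "\<And>x. x \<in> C \<Longrightarrow> x \<notin> B \<Longrightarrow> transition u x \<le> u x"
    and x: "x \<in> C"
  shows "emeasure S.S (E x) \<le> u x"
proof -
  have sp: "space S.S = UNIV"
    by (simp add: space_PiM PiE_UNIV_domain)
  \<comment> \<open>The part of \<open>E x\<close> where \<open>B\<close> is entered by time
    \<open>n\<close>. By \<open>visit\<close> it increases to \<open>E x\<close>, so a bound uniform
    in \<open>n\<close> carries over to \<open>E x\<close>.\<close>
  define F where "F n x = E x \<inter> {\<omega>. \<exists>k\<le>n. path x \<omega> k \<in> B}" for n x
  have F_sets: "F n x \<in> sets S.S" if "x \<in> C" for n x
  proof -
    have "{\<omega>. path x \<omega> k \<in> B} \<in> sets S.S" for k
      using measurable_sets[OF measurable_path[OF that], of B k] by (simp add: vimage_def sp)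
    then have "(\<Union>k\<in>{..n}. {\<omega>. path x \<omega> k \<in> B}) \<in> sets S.S"
      by (intro sets.finite_UN) auto
    moreover have "F n x = E x \<inter> (\<Union>k\<in>{..n}. {\<omega>. path x \<omega> k \<in> B})"
      by (auto simp: F_def)
    ultimately show ?thesis
      using sets[OF that] by auto
  qed
  have bound: "emeasure S.S (F n x) \<le> u x" if "x \<in> C" for n x
    using that
  proof (induction n arbitrary: x)
    case (0 x)
    show ?case
    proof (cases "x \<in> B")
      case True
      then have "F 0 x = E x" by (auto simp: F_def)
      then show ?thesis using inside[OF 0 True] by simp
    next
      case False
      then show ?thesis by (simp add: F_def)
    qed
  next
    case (Suc n x)
    show ?case
    proof (cases "x \<in> B")
      case True
      have "emeasure S.S (F (Suc n) x) \<le> emeasure S.S (E x)"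
        by (rule emeasure_mono) (auto simp: F_def sets Suc.prems)
      then show ?thesis using inside[OF Suc.prems True] by simp
    next
      case False
      \<comment> \<open>A path that starts outside \<open>B\<close> has all its visits at positive
        times, and these survive the removal of the first letter.\<close>
      have ex: "(\<exists>k\<le>Suc n. path x (case_nat s \<omega>) k \<in> B) \<longleftrightarrow> (\<exists>k\<le>n. path (f x s) \<omega> k \<in> B)" for s \<omega>
        using False by (auto simp: ex_simps iterate_case_nat[symmetric] simp del: iterate.simps(2)
            intro: exI[of _ "Suc _"] elim: le_SucE)
          (metis Suc_le_mono iterate.simps(1) not0_implies_Suc)
      have "emeasure S.S (F (Suc n) x) = (\<integral>\<^sup>+ s. emeasure S.S {\<omega>. case_nat s \<omega> \<in> F (Suc n) x} \<partial>measure_pmf \<mu>)"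
        by (rule emeasure_first_step[OF F_sets[OF Suc.prems]])
      also have "\<dots> = (\<integral>\<^sup>+ s. emeasure S.S (F n (f x s)) \<partial>measure_pmf \<mu>)"
        by (rule nn_integral_cong, rule arg_cong[where f = "emeasure S.S"])
          (simp only: F_def Int_iff mem_Collect_eq ex shift[OF Suc.prems] Collect_conj_eq Collect_mem_eq)
      also have "\<dots> \<le> transition u x"
        unfolding transition_def by (intro nn_integral_mono Suc.IH step_closed Suc.prems)
      also have "\<dots> \<le> u x"
        by (rule outside[OF Suc.prems False])
      finally show ?thesis .
    qed
  qed
  have "E x = (\<Union>n. F n x)"
    using visit[OF x] by (fastforce simp: F_def)
  then have "emeasure S.S (E x) = (SUP n. emeasure S.S (F n x))"
    using F_sets[OF x] by (subst SUP_emeasure_incseq) (auto simp: incseq_def F_def intro: order_trans)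
  also have "\<dots> \<le> u x"
    by (intro SUP_least bound x)
  finally show ?thesis .
qed

lemma transition_harmonic:
  fixes h :: "'a \<Rightarrow> real"
  assumes "\<And>x. x \<in> C \<Longrightarrow> 0 \<le> h x" "\<And>x. x \<in> C \<Longrightarrow> h x \<le> 1" "x \<in> C"
  shows "transition (\<lambda>y. ennreal (h y)) x = ennreal (\<integral>s. h (f x s) \<partial>measure_pmf \<mu>)"
  unfolding transition_def
  using assms step_closed
  by (intro nn_integral_eq_integral measure_pmf.integrable_const_bound[where B = 1]) auto

end

section \<open>Almost sure convergence of bounded harmonic functions along paths\<close>

text \<open>Compactness of the unit interval gives two subsequences with different limits, and
  \<open>a < b\<close> are taken strictly between these. They are rational so that only countably
  many null events have to be excluded later.\<close>

lemma not_convergent_oscillates: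
  fixes X :: "nat \<Rightarrow> real"
  assumes bnd: "\<And>n. 0 \<le> X n" "\<And>n. X n \<le> 1" and nc: "\<not> convergent X"
  obtains a b :: real where "a \<in> \<rat>" "b \<in> \<rat>" "0 \<le> a" "a < b" "\<exists>\<^sub>\<infinity>n. X n \<le> a" "\<exists>\<^sub>\<infinity>n. b \<le> X n"
proof -
  have comp: "seq_compact {0..1::real}" by (simp add: compact_imp_seq_compact)
  obtain l1 r1 where l1: "strict_mono r1" "(X \<circ> r1) \<longlonglongrightarrow> l1"
    by (rule seq_compactE[OF comp, of X]) (auto simp: bnd)
  have "\<not> X \<longlonglongrightarrow> l1"
    using nc convergent_def by blast
  then obtain e where e: "e > 0" "\<exists>\<^sub>\<infinity>n. dist (X n) l1 \<ge> e"
    unfolding tendsto_iff cofinite_eq_sequentially frequently_def not_le[symmetric] by auto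
  then have inf: "infinite {n. dist (X n) l1 \<ge> e}"
    by (simp add: INFM_iff_infinite)
  obtain r where r: "strict_mono r" "\<And>n::nat. dist (X (r n)) l1 \<ge> e"
    using infinite_enumerate[OF inf] by auto
  obtain l2 r2 where l2: "strict_mono r2" "((X \<circ> r) \<circ> r2) \<longlonglongrightarrow> l2"
    by (rule seq_compactE[OF comp, of "X \<circ> r"]) (auto simp: bnd)
  have "(\<lambda>n. dist (((X \<circ> r) \<circ> r2) n) l1) \<longlonglongrightarrow> dist l2 l1"
    by (intro tendsto_intros l2)
  then have "e \<le> dist l2 l1"
    by (rule LIMSEQ_le_const) (use r in auto)
  then have ne: "l1 \<noteq> l2" using e by auto
  have freq: "\<exists>\<^sub>\<infinity>n. P (X n)" if "strict_mono r'" "\<forall>\<^sub>F n in sequentially. P (X (r' n))" for P r'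
  proof -
    from that(2) obtain N where N: "\<And>n. n \<ge> N \<Longrightarrow> P (X (r' n))"
      by (auto simp: eventually_sequentially)
    show ?thesis unfolding INFM_nat_le
    proof
      fix m
      have "P (X (r' (max N m)))" "m \<le> r' (max N m)"
        using N seq_suble[OF that(1), of "max N m"] by auto
      then show "\<exists>n\<ge>m. P (X n)" by blast
    qed
  qed
  have s1: "strict_mono r1" and s2: "strict_mono (r \<circ> r2)"
    using l1 l2 r by (auto simp: strict_mono_o)
  have e1: "\<forall>\<^sub>F n in sequentially. X (r1 n) < c" if "l1 < c" for c
    using order_tendstoD(2)[OF l1(2) that] by simp
  have e1': "\<forall>\<^sub>F n in sequentially. c < X (r1 n)" if "c < l1" for c
    using order_tendstoD(1)[OF l1(2) that] by simp
  have e2: "\<forall>\<^sub>F n in sequentially. X ((r \<circ> r2) n) < c" if "l2 < c" for c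
    using order_tendstoD(2)[OF l2(2) that] by simp
  have e2': "\<forall>\<^sub>F n in sequentially. c < X ((r \<circ> r2) n)" if "c < l2" for c
    using order_tendstoD(1)[OF l2(2) that] by simp
  have mm: "min l1 l2 < max l1 l2" using ne by auto
  from Rats_dense_in_real[OF mm] obtain a where a: "a \<in> \<rat>" "min l1 l2 < a" "a < max l1 l2" by auto
  from Rats_dense_in_real[OF a(3)] obtain b where b: "b \<in> \<rat>" "a < b" "b < max l1 l2" by auto
  note ab = a(1) b(1) a(2) b(2,3)
  have low: "\<exists>\<^sub>\<infinity>n. X n < a"
    using ab(3) freq[OF s1 e1] freq[OF s2 e2] by (auto simp: min_less_iff_disj)
  have high: "\<exists>\<^sub>\<infinity>n. b < X n"
    using ab(5) freq[OF s1 e1'] freq[OF s2 e2'] by (auto simp: less_max_iff_disj)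
  from low obtain n where "X n < a" by (auto dest: INFM_EX)
  then have "0 \<le> a" using bnd(1)[of n] by simp
  moreover have "\<exists>\<^sub>\<infinity>n. X n \<le> a" "\<exists>\<^sub>\<infinity>n. b \<le> X n"
    using low high by (auto elim: INFM_mono)
  ultimately show thesis
    using that ab by blast
qed

context random_iteration
begin

text \<open>Optional stopping replaces the upcrossing inequality. Let \<open>Q\<close> be the
  supremum of the probability of oscillation over all starting points. Reaching
  \<open>b \<le> h\<close> from \<open>y\<close> costs a factor \<open>h y / b\<close>, which is at
  most \<open>a / b\<close> where \<open>h \<le> a\<close>. Every oscillating path visits the latter
  set, so \<open>Q \<le> Q * (a / b)\<close> and \<open>Q = 0\<close>.\<close>

lemma AE_no_oscillation:
  fixes h :: "'a \<Rightarrow> real"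
  assumes h: "\<And>x. x \<in> C \<Longrightarrow> 0 \<le> h x" "\<And>x. x \<in> C \<Longrightarrow> h x \<le> 1"
    and harm: "\<And>x. x \<in> C \<Longrightarrow> (\<integral>s. h (f x s) \<partial>measure_pmf \<mu>) = h x"
    and ab: "0 \<le> a" "a < b" and x: "x \<in> C"
  shows "AE \<omega> in S.S. \<not> ((\<exists>\<^sub>\<infinity>n. h (path x \<omega> n) \<le> a) \<and> (\<exists>\<^sub>\<infinity>n. b \<le> h (path x \<omega> n)))"
proof -
  have sp: "space S.S = UNIV"
    by (simp add: space_PiM PiE_UNIV_domain)
  define E where "E x = {\<omega>. (\<exists>\<^sub>\<infinity>n. h (path x \<omega> n) \<le> a) \<and> (\<exists>\<^sub>\<infinity>n. b \<le> h (path x \<omega> n))}" for x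
  have E_sets: "E x \<in> sets S.S" if "x \<in> C" for x
  proof -
    have [measurable]: "(\<lambda>\<omega>. h (path x \<omega> n)) \<in> borel_measurable S.S" for n
      by (rule measurable_compose[OF measurable_path[OF that]]) simp
    have "{\<omega>\<in>space S.S. (\<exists>\<^sub>\<infinity>n. h (path x \<omega> n) \<le> a) \<and> (\<exists>\<^sub>\<infinity>n. b \<le> h (path x \<omega> n))} \<in> sets S.S"
      unfolding INFM_nat_le by measurable
    then show ?thesis by (simp add: E_def sp)
  qed
  have inf_shift: "(\<exists>\<^sub>\<infinity>n. P (path x (case_nat s \<omega>) n)) \<longleftrightarrow> (\<exists>\<^sub>\<infinity>n. P (path (f x s) \<omega> n))" for P x s \<omega>
    unfolding iterate_case_nat[symmetric] cofinite_eq_sequentially frequently_def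
    using eventually_sequentially_Suc[of "\<lambda>n. \<not> P (path x (case_nat s \<omega>) n)"] by simp
  have E_shift: "case_nat s \<omega> \<in> E x \<longleftrightarrow> \<omega> \<in> E (f x s)" for x s \<omega>
    using inf_shift[of "\<lambda>y. h y \<le> a"] inf_shift[of "\<lambda>y. b \<le> h y"] by (simp add: E_def)
  have tr: "transition (\<lambda>y. c * ennreal (h y)) y = c * ennreal (h y)" if "y \<in> C" for c y
    using transition_harmonic[of h y, OF h that] harm[OF that]
    by (simp add: transition_def nn_integral_cmult)
  define Q where "Q = (SUP x\<in>C. emeasure S.S (E x))"
  have Q: "emeasure S.S (E y) \<le> Q" if "y \<in> C" for y
    unfolding Q_def using that by (rule SUP_upper)
  have Q1: "Q \<le> 1"
    unfolding Q_def by (intro SUP_least S.emeasure_le_1)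
  have b: "0 < b" using ab by simp
  \<comment> \<open>The multiple \<open>Q / b\<close> of \<open>h\<close> is preserved by
    \<open>transition\<close> and is at least \<open>Q\<close> wherever
    \<open>b \<le> h\<close>.\<close>
  have up: "emeasure S.S (E y) \<le> Q * ennreal (1 / b) * ennreal (h y)" if "y \<in> C" for y
  proof (rule emeasure_le_supersolution[where E = E and B = "{y. b \<le> h y}"
        and u = "\<lambda>y. Q * ennreal (1 / b) * ennreal (h y)", OF E_sets E_shift _ _ _ that])
    fix y assume y: "y \<in> C" "y \<in> {y. b \<le> h y}"
    then have "1 \<le> ennreal (1 / b) * ennreal (h y)"
      using b h(1)[of y] by (subst ennreal_mult[symmetric]) auto
    then have "Q * 1 \<le> Q * (ennreal (1 / b) * ennreal (h y))"
      by (rule mult_left_mono) simp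
    then show "emeasure S.S (E y) \<le> Q * ennreal (1 / b) * ennreal (h y)"
      using Q[OF y(1)] by (simp add: mult.assoc)
  qed (auto simp: E_def tr dest!: INFM_EX)
  \<comment> \<open>Here the supersolution is a constant; on the set \<open>h \<le> a\<close> the
    required bound comes from \<open>up\<close>.\<close>
  have down: "emeasure S.S (E y) \<le> Q * ennreal (a / b)" if "y \<in> C" for y
  proof (rule emeasure_le_supersolution[where E = E and B = "{y. h y \<le> a}"
        and u = "\<lambda>y. Q * ennreal (a / b)", OF E_sets E_shift _ _ _ that])
    fix y assume y: "y \<in> C" "y \<in> {y. h y \<le> a}"
    then have "ennreal (1 / b) * ennreal (h y) \<le> ennreal (a / b)"
      using b h(1)[of y] by (subst ennreal_mult[symmetric]) (auto intro!: divide_right_mono)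
    then have "Q * (ennreal (1 / b) * ennreal (h y)) \<le> Q * ennreal (a / b)"
      by (rule mult_left_mono) simp
    then show "emeasure S.S (E y) \<le> Q * ennreal (a / b)"
      using up[OF y(1)] by (simp add: mult.assoc)
  qed (auto simp: E_def transition_def dest!: INFM_EX)
  have "Q \<le> Q * ennreal (a / b)"
    unfolding Q_def[of] using down by (auto intro!: SUP_least simp: Q_def)
  moreover obtain q where q: "Q = ennreal q" "0 \<le> q"
    using Q1 by (cases Q) (auto simp: top_unique)
  ultimately have "q \<le> q * (a / b)"
    using ab b by (simp flip: ennreal_mult'' )
  then have "q * (b - a) \<le> 0" using b by (simp add: field_simps)
  then have "Q = 0" using q ab by (simp add: mult_le_0_iff)
  then have "E x \<in> null_sets S.S"
    using Q[OF x] E_sets[OF x] by auto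
  from AE_not_in[OF this] show ?thesis
    by (simp add: E_def)
qed

lemma AE_harmonic_convergent:
  fixes h :: "'a \<Rightarrow> real"
  assumes h: "\<And>x. x \<in> C \<Longrightarrow> 0 \<le> h x" "\<And>x. x \<in> C \<Longrightarrow> h x \<le> 1"
    and harm: "\<And>x. x \<in> C \<Longrightarrow> (\<integral>s. h (f x s) \<partial>measure_pmf \<mu>) = h x"
    and x: "x \<in> C"
  shows "AE \<omega> in S.S. convergent (\<lambda>n. h (path x \<omega> n))"
proof -
  have "AE \<omega> in S.S. \<forall>(a, b)\<in>(\<rat> \<times> \<rat>) \<inter> {(a, b). 0 \<le> a \<and> a < b}.
      \<not> ((\<exists>\<^sub>\<infinity>n. h (path x \<omega> n) \<le> a) \<and> (\<exists>\<^sub>\<infinity>n. b \<le> h (path x \<omega> n)))"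
    unfolding split_beta
    by (subst AE_ball_countable)
      (auto intro!: countable_Int1 countable_SIGMA countable_rat simp del: not_INFM de_Morgan_conj
        intro: AE_no_oscillation[OF h harm _ _ x])
  then show ?thesis
  proof eventually_elim
    case (elim \<omega>)
    show ?case
    proof (rule ccontr)
      assume "\<not> convergent (\<lambda>n. h (path x \<omega> n))"
      with not_convergent_oscillates[of "\<lambda>n. h (path x \<omega> n)"] h path_in[OF x]
      obtain a b where "a \<in> \<rat>" "b \<in> \<rat>" "0 \<le> a" "a < b"
        "\<exists>\<^sub>\<infinity>n. h (path x \<omega> n) \<le> a" "\<exists>\<^sub>\<infinity>n. b \<le> h (path x \<omega> n)"
        by metis
      with elim show False by fastforce
    qed
  qed
qed

section \<open>Potentials and the energy of harmonic functions\<close>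

lemma transition_add: "transition (\<lambda>x. u x + v x) x = transition u x + transition v x"
  by (simp add: transition_def nn_integral_add)

lemma transition_mono:
  "x \<in> C \<Longrightarrow> (\<And>y. y \<in> C \<Longrightarrow> u y \<le> v y) \<Longrightarrow> transition u x \<le> transition v x"
  unfolding transition_def by (intro nn_integral_mono) (auto simp: step_closed)

lemma transition_pow_mono:
  "x \<in> C \<Longrightarrow> (\<And>y. y \<in> C \<Longrightarrow> u y \<le> v y) \<Longrightarrow> (transition ^^ n) u x \<le> (transition ^^ n) v x"
  by (induction n arbitrary: x) (auto intro!: transition_mono)

lemma transition_pow_add:
  "(transition ^^ n) (\<lambda>x. u x + v x) x = (transition ^^ n) u x + (transition ^^ n) v x"
proof (induction n arbitrary: x)
  case (Suc n)
  then have "(transition ^^ n) (\<lambda>x. u x + v x) = (\<lambda>x. (transition ^^ n) u x + (transition ^^ n) v x)"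
    by auto
  then show ?case by (simp add: transition_add)
qed simp

lemma transition_pow_cmult:
  "(transition ^^ n) (\<lambda>x. c * u x) x = c * (transition ^^ n) u x"
proof (induction n arbitrary: x)
  case (Suc n)
  then have "(transition ^^ n) (\<lambda>x. c * u x) = (\<lambda>x. c * (transition ^^ n) u x)"
    by auto
  then show ?case by (simp add: transition_def[of "\<lambda>x. c * _ x"] transition_def[of "(transition ^^ n) u"] nn_integral_cmult)
qed simp

text \<open>The potential of \<open>u\<close>: for \<open>x\<close> in \<open>C\<close> this is the
  expected sum of \<open>u\<close> along the path from \<open>x\<close>, by
  \<open>nn_integral_path\<close>.\<close>

definition green :: "'a \<Rightarrow> ('a \<Rightarrow> ennreal) \<Rightarrow> ennreal" where
  "green x u = (\<Sum>n. (transition ^^ n) u x)"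

lemma green_mono: "x \<in> C \<Longrightarrow> (\<And>y. y \<in> C \<Longrightarrow> u y \<le> v y) \<Longrightarrow> green x u \<le> green x v"
  unfolding green_def by (intro suminf_le transition_pow_mono) auto

lemma green_cmult: "green x (\<lambda>y. c * u y) = c * green x u"
  unfolding green_def transition_pow_cmult by simp

lemma green_transition: "green x (transition u) \<le> green x u"
proof -
  have "green x u = u x + green x (transition u)"
    unfolding green_def
    using suminf_offset[of "\<lambda>n. (transition ^^ n) u x" 1] 
    by (simp add: funpow_swap1 del: suminf_offset)
  then show ?thesis by simp
qed

text \<open>Orthogonality of martingale increments: harmonicity determines the cross term, so one
  step raises the mean of the square of \<open>h\<close> by exactly the mean of \<open>D\<close>.
  The sum telescopes, and the square of \<open>h\<close> stays below 1.\<close>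

lemma green_energy:
  fixes h :: "'a \<Rightarrow> real"
  assumes h: "\<And>x. x \<in> C \<Longrightarrow> 0 \<le> h x" "\<And>x. x \<in> C \<Longrightarrow> h x \<le> 1"
    and harm: "\<And>x. x \<in> C \<Longrightarrow> (\<integral>s. h (f x s) \<partial>measure_pmf \<mu>) = h x"
    and x: "x \<in> C"
  shows "green x (\<lambda>y. ennreal (\<integral>s. (h (f y s) - h y)\<^sup>2 \<partial>measure_pmf \<mu>)) \<le> 1"
proof -
  define D where "D y = (\<integral>s. (h (f y s) - h y)\<^sup>2 \<partial>measure_pmf \<mu>)" for y
  let ?h2 = "\<lambda>y. ennreal ((h y)\<^sup>2)" and ?D = "\<lambda>y. ennreal (D y)"
  have hb: "\<bar>h (f y s)\<bar> \<le> 1" "(h y)\<^sup>2 \<le> 1" if "y \<in> C" for y s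
    using h[OF that] h[OF step_closed[OF that, of s]] by (auto simp: power_le_one)
  have one: "?D y + ?h2 y = transition ?h2 y" if "y \<in> C" for y
  proof -
    have int: "integrable (measure_pmf \<mu>) (\<lambda>s. h (f y s))" "integrable (measure_pmf \<mu>) (\<lambda>s. (h (f y s))\<^sup>2)"
      using hb[OF that] hb(2)[OF step_closed[OF that]]
      by (auto intro!: measure_pmf.integrable_const_bound[where B = 1])
    have "D y = (\<integral>s. (h (f y s))\<^sup>2 - 2 * h y * h (f y s) + (h y)\<^sup>2 \<partial>measure_pmf \<mu>)"
      unfolding D_def by (simp add: power2_diff algebra_simps)
    also have "\<dots> = (\<integral>s. (h (f y s))\<^sup>2 \<partial>measure_pmf \<mu>) - 2 * h y * h y + (h y)\<^sup>2"
      using int by (simp add: harm[OF that])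
    finally have "D y + (h y)\<^sup>2 = (\<integral>s. (h (f y s))\<^sup>2 \<partial>measure_pmf \<mu>)"
      by (simp add: power2_eq_square)
    moreover have "0 \<le> D y" unfolding D_def by simp
    ultimately show ?thesis
      using transition_harmonic[of "\<lambda>y. (h y)\<^sup>2", OF _ hb(2) that]
      by (simp flip: ennreal_plus)
  qed
  have "(\<Sum>n<N. (transition ^^ n) ?D x) + ?h2 x \<le> (transition ^^ N) ?h2 x" for N
  proof (induction N)
    case (Suc N)
    have "(\<Sum>n<Suc N. (transition ^^ n) ?D x) + ?h2 x \<le> (transition ^^ N) ?D x + (transition ^^ N) ?h2 x"
      using add_left_mono[OF Suc, of "(transition ^^ N) ?D x"] by (simp add: ac_simps)
    also have "\<dots> = (transition ^^ N) (\<lambda>y. ?D y + ?h2 y) x"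
      by (rule transition_pow_add[symmetric])
    also have "\<dots> \<le> (transition ^^ N) (transition ?h2) x"
      using one by (intro transition_pow_mono x) auto
    finally show ?case by (simp add: funpow_swap1)
  qed simp
  moreover have "(transition ^^ N) ?h2 x \<le> 1" for N
  proof -
    have "(transition ^^ N) ?h2 x = (\<integral>\<^sup>+ \<omega>. ?h2 (path x \<omega> N) \<partial>S.S)"
      by (rule nn_integral_path[OF x, symmetric])
    also have "\<dots> \<le> (\<integral>\<^sup>+ \<omega>. 1 \<partial>S.S)"
      by (intro nn_integral_mono) (simp add: hb(2) path_in[OF x] ennreal_le_1)
    finally show ?thesis by (simp add: S.emeasure_space_1)
  qed
  ultimately have "(\<Sum>n<N. (transition ^^ n) ?D x) \<le> 1" for N
    by (metis (no_types, lifting) add_increasing2 dual_order.trans le_iff_add)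
  then show ?thesis
    unfolding green_def D_def[symmetric] by (intro suminf_le_const) auto
qed

end

section \<open>Stationary means\<close>

lemma pmf_finite_tail:
  fixes \<mu> :: "'s pmf" and e :: real
  assumes "e > 0"
  obtains K where "finite K" "measure_pmf.prob \<mu> (- K) < e"
proof -
  let ?A = "\<lambda>n. from_nat_into (set_pmf \<mu>) ` {..n}"
  have "(\<lambda>n. measure_pmf.prob \<mu> (?A n)) \<longlonglongrightarrow> measure_pmf.prob \<mu> (\<Union>n. ?A n)"
    by (rule measure_pmf.finite_Lim_measure_incseq) (auto simp: incseq_def)
  moreover have "(\<Union>n. ?A n) = from_nat_into (set_pmf \<mu>) ` (\<Union>n. {..n})"
    by (rule image_UN[symmetric])
  then have "(\<Union>n. ?A n) = set_pmf \<mu>"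
    using range_from_nat_into[OF set_pmf_not_empty countable_set_pmf, of \<mu>]
    by (simp add: UN_atMost_UNIV)
  ultimately have "(\<lambda>n. measure_pmf.prob \<mu> (?A n)) \<longlonglongrightarrow> 1"
    by (simp add: measure_pmf.prob_eq_1[THEN iffD2] AE_measure_pmf)
  then have "\<forall>\<^sub>F n in sequentially. 1 - e < measure_pmf.prob \<mu> (?A n)"
    using assms by (intro order_tendstoD) auto
  then obtain n where "1 - e < measure_pmf.prob \<mu> (?A n)"
    by (auto simp: eventually_sequentially)
  then have "measure_pmf.prob \<mu> (- ?A n) < e"
    using measure_pmf.prob_compl[of "?A n" \<mu>] by (simp add: Compl_eq_Diff_UNIV)
  then show thesis
    by (rule that[rotated]) simp
qed

text \<open>Dominated convergence along a filter that need not have a countable base.\<close>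

lemma tendsto_integral_pmf:
  fixes g :: "'i \<Rightarrow> 's \<Rightarrow> real"
  assumes lim: "\<And>s. s \<in> set_pmf \<mu> \<Longrightarrow> ((\<lambda>i. g i s) \<longlongrightarrow> l s) F"
    and bnd: "\<forall>\<^sub>F i in F. \<forall>s. \<bar>g i s\<bar> \<le> 1"
  shows "((\<lambda>i. \<integral>s. g i s \<partial>measure_pmf \<mu>) \<longlongrightarrow> (\<integral>s. l s \<partial>measure_pmf \<mu>)) F"
proof (cases "F = bot")
  case False
  have l1: "\<bar>l s\<bar> \<le> 1" if "s \<in> set_pmf \<mu>" for s
    by (rule tendsto_upperbound[OF tendsto_rabs[OF lim[OF that]] _ False])
      (use bnd in \<open>auto elim: eventually_mono\<close>)
  show ?thesis
  proof (rule tendstoI)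
    fix e :: real assume e: "e > 0"
    obtain K where K: "finite K" "measure_pmf.prob \<mu> (- K) < e / 4"
      using pmf_finite_tail[of "e / 4" \<mu>] e by auto
    have "\<forall>\<^sub>F i in F. \<forall>s\<in>K \<inter> set_pmf \<mu>. \<bar>g i s - l s\<bar> < e / 2"
      using K(1) tendstoD[OF lim, of _ "e / 2"] e
      by (intro eventually_ball_finite) (auto simp: dist_real_def)
    with bnd show "\<forall>\<^sub>F i in F. dist (\<integral>s. g i s \<partial>measure_pmf \<mu>) (\<integral>s. l s \<partial>measure_pmf \<mu>) < e"
    proof eventually_elim
      case (elim i)
      have int: "integrable (measure_pmf \<mu>) (g i)" "integrable (measure_pmf \<mu>) l"
        using elim l1 by (auto intro!: measure_pmf.integrable_const_bound[where B = 1] simp: AE_measure_pmf_iff)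
      have "\<bar>(\<integral>s. g i s \<partial>measure_pmf \<mu>) - (\<integral>s. l s \<partial>measure_pmf \<mu>)\<bar>
          = \<bar>\<integral>s. g i s - l s \<partial>measure_pmf \<mu>\<bar>"
        using int by simp
      also have "\<dots> \<le> (\<integral>s. \<bar>g i s - l s\<bar> \<partial>measure_pmf \<mu>)"
        by (rule integral_abs_bound)
      \<comment> \<open>On the finite set \<open>K\<close> the integrands differ by less than
        \<open>e / 2\<close>; elsewhere they differ by at most 2, on a set of probability below
        \<open>e / 4\<close>.\<close>
      also have "\<dots> \<le> (\<integral>s. e / 2 + 2 * indicator (- K) s \<partial>measure_pmf \<mu>)"
      proof (rule integral_mono_AE)
        show "AE s in measure_pmf \<mu>. \<bar>g i s - l s\<bar> \<le> e / 2 + 2 * indicator (- K) s"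
        proof (rule AE_pmfI)
          fix s assume s: "s \<in> set_pmf \<mu>"
          show "\<bar>g i s - l s\<bar> \<le> e / 2 + 2 * indicator (- K) s"
          proof (cases "s \<in> K")
            case True
            then show ?thesis using elim(2) s by (auto simp: less_imp_le)
          next
            case False
            have "\<bar>g i s\<bar> \<le> 1" "\<bar>l s\<bar> \<le> 1" using elim(1) l1[OF s] by auto
            then show ?thesis using False e by (simp add: abs_le_iff)
          qed
        qed
      qed (use int in \<open>auto intro!: integrable_add integrable_mult_right integrable_real_indicator simp: measure_pmf.emeasure_eq_measure\<close>)
      also have "\<dots> = e / 2 + 2 * measure_pmf.prob \<mu> (- K)"
        by (subst Bochner_Integration.integral_add) (auto simp: measure_pmf.emeasure_eq_measure intro!: integrable_real_indicator)
      also have "\<dots> < e" using K(2) by simp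
      finally show ?case by (simp add: dist_real_def)
    qed
  qed
qed simp

lemma measure_bind_map_pmf:
  "measure_pmf.prob (bind_pmf \<mu> (\<lambda>s. map_pmf (T s) q)) A =
    (\<integral>s. measure_pmf.prob q (T s -` A) \<partial>measure_pmf \<mu>)"
proof -
  have "ennreal (measure_pmf.prob (bind_pmf \<mu> (\<lambda>s. map_pmf (T s) q)) A) =
      (\<integral>\<^sup>+ s. ennreal (measure_pmf.prob q (T s -` A)) \<partial>measure_pmf \<mu>)"
    by (simp flip: measure_pmf.emeasure_eq_measure)
  also have "\<dots> = ennreal (\<integral>s. measure_pmf.prob q (T s -` A) \<partial>measure_pmf \<mu>)"
    by (intro nn_integral_eq_integral measure_pmf.integrable_const_bound[where B = 1]) auto
  finally show ?thesis
    by (simp add: integral_nonneg_AE)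
qed

locale stationary_mean =
  fixes \<mu> :: "'s pmf" and T :: "'s \<Rightarrow> 'm \<Rightarrow> 'm" and \<nu> :: "'m set \<Rightarrow> real"
  assumes mean_nonneg: "0 \<le> \<nu> A"
    and mean_UNIV: "\<nu> UNIV = 1"
    and mean_Un: "A \<inter> B = {} \<Longrightarrow> \<nu> (A \<union> B) = \<nu> A + \<nu> B"
    and mean_stationary: "\<nu> A = (\<integral>s. \<nu> (T s -` A) \<partial>measure_pmf \<mu>)"

text \<open>A cluster point of the time averages of the distributions of the chain
  \<open>x, T s\<^sub>1 x, T s\<^sub>2 (T s\<^sub>1 x), \<dots>\<close>. Being only finitely additive, it needs no
  compactness of the space of measures on \<open>M\<close> beyond the Tychonoff theorem.\<close>

lemma ex_stationary_mean:
  fixes \<mu> :: "'s pmf" and T :: "'s \<Rightarrow> 'm \<Rightarrow> 'm"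
  assumes x: "x \<in> Y" and Y: "\<And>s y. s \<in> set_pmf \<mu> \<Longrightarrow> y \<in> Y \<Longrightarrow> T s y \<in> Y"
  obtains \<nu> where "stationary_mean \<mu> T \<nu>" "\<nu> Y = 1"
proof -
  \<comment> \<open>The newly drawn map acts last, so \<open>q k\<close> is the law of the chain
    after \<open>k\<close> steps.\<close>
  define step where "step q = bind_pmf \<mu> (\<lambda>s. map_pmf (T s) q)" for q
  define q where "q k = (step ^^ k) (return_pmf x)" for k
  define avg where "avg N A = (\<Sum>k<Suc N. measure_pmf.prob (q k) A) / real (Suc N)" for N and A :: "'m set"
  have q_Suc: "measure_pmf.prob (q (Suc k)) A = (\<integral>s. measure_pmf.prob (q k) (T s -` A) \<partial>measure_pmf \<mu>)" for k A
    by (simp add: q_def step_def measure_bind_map_pmf)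
  have q_Y: "set_pmf (q k) \<subseteq> Y" for k
    by (induction k) (use x Y in \<open>auto simp: q_def step_def\<close>)
  have avg_nonneg: "0 \<le> avg N A" for N A
    unfolding avg_def by (intro divide_nonneg_nonneg sum_nonneg) auto
  have avg_UNIV: "avg N UNIV = 1" for N
    by (simp add: avg_def measure_pmf.prob_space)
  have avg_Y: "avg N Y = 1" for N
  proof -
    have "measure_pmf.prob (q k) Y = 1" for k
      using q_Y by (auto simp: measure_pmf.prob_eq_1 AE_measure_pmf_iff)
    then show ?thesis by (simp add: avg_def)
  qed
  have avg_le1: "avg N A \<le> 1" for N A
  proof -
    have "(\<Sum>k<Suc N. measure_pmf.prob (q k) A) \<le> (\<Sum>k<Suc N. 1)"
      by (intro sum_mono) simp
    then show ?thesis by (simp add: avg_def divide_le_eq)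
  qed
  have avg_Un: "avg N (A \<union> B) = avg N A + avg N B" if "A \<inter> B = {}" for N A B
    using that by (simp add: avg_def measure_pmf.finite_measure_Union sum.distrib add_divide_distrib)
  \<comment> \<open>One more step shifts the index of summation, so only the first and the last term
    survive, and both lie between 0 and 1.\<close>
  have avg_stat: "\<bar>(\<integral>s. avg N (T s -` A) \<partial>measure_pmf \<mu>) - avg N A\<bar> \<le> 1 / real (Suc N)" for N A
  proof -
    have "(\<integral>s. avg N (T s -` A) \<partial>measure_pmf \<mu>) = (\<Sum>k<Suc N. measure_pmf.prob (q (Suc k)) A) / real (Suc N)"
      unfolding avg_def q_Suc
      by (subst integral_divide_zero, subst Bochner_Integration.integral_sum)
        (auto intro!: measure_pmf.integrable_const_bound[where B = 1])
    moreover have "(\<Sum>k<Suc N. measure_pmf.prob (q (Suc k)) A) - (\<Sum>k<Suc N. measure_pmf.prob (q k) A) =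
        measure_pmf.prob (q (Suc N)) A - measure_pmf.prob (q 0) A"
      unfolding sum_subtractf[symmetric] by (rule sum_lessThan_telescope)
    ultimately have "(\<integral>s. avg N (T s -` A) \<partial>measure_pmf \<mu>) - avg N A =
        (measure_pmf.prob (q (Suc N)) A - measure_pmf.prob (q 0) A) / real (Suc N)"
      unfolding avg_def[of N A] by (simp only: diff_divide_distrib[symmetric])
    moreover have "\<bar>measure_pmf.prob (q (Suc N)) A - measure_pmf.prob (q 0) A\<bar> \<le> 1"
      using measure_pmf.prob_le_1[of "q (Suc N)" A] measure_pmf.prob_le_1[of "q 0" A]
        measure_nonneg[of "q (Suc N)" A] measure_nonneg[of "q 0" A] by linarith
    ultimately show ?thesis
      by (simp only: abs_divide) (simp add: divide_right_mono)
  qed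
  \<comment> \<open>All functions from sets to the unit interval form a compact product. As its
    index set consists of all subsets of the type, a cluster point is used in place of a convergent
    subsequence; along the filter \<open>L\<close> below the averages converge to it on every
    set.\<close>
  define Q :: "('m set \<Rightarrow> real) set" where "Q = PiE UNIV (\<lambda>_. {0..1})"
  have "compactin (product_topology (\<lambda>_. euclidean) UNIV) Q"
    by (simp add: Q_def compactin_PiE)
  then have "compact Q"
    by (simp add: euclidean_product_topology)
  moreover have "\<forall>\<^sub>F p in filtermap avg sequentially. p \<in> Q"
    by (simp add: eventually_filtermap Q_def PiE_iff avg_nonneg avg_le1)
  ultimately obtain \<nu> where \<nu>: "inf (nhds \<nu>) (filtermap avg sequentially) \<noteq> bot"
    unfolding compact_filter by (metis filtermap_bot_iff sequentially_bot)
  define L where "L = inf (nhds \<nu>) (filtermap avg sequentially)"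
  have L: "L \<noteq> bot" "L \<le> nhds \<nu>" "L \<le> filtermap avg sequentially"
    using \<nu> by (auto simp: L_def)
  have lim: "((\<lambda>p. p A) \<longlongrightarrow> \<nu> A) L" for A
  proof -
    have "continuous_on UNIV (\<lambda>p::'m set \<Rightarrow> real. p A)"
      by (rule continuous_on_product_coordinates)
    then have "((\<lambda>p. p A) \<longlongrightarrow> \<nu> A) (nhds \<nu>)"
      using continuous_on_def tendsto_at_iff_tendsto_nhds by (metis UNIV_I)
    then show ?thesis by (rule tendsto_mono[OF L(2)])
  qed
  have ev: "\<forall>\<^sub>F p in L. P p" if "\<forall>\<^sub>F N in sequentially. P (avg N)" for P
    using that L(3) by (auto simp: le_filter_def eventually_filtermap)
  have ev_eq: "\<nu> A = c" if "\<And>N. avg N A = c" for A c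
    by (rule tendsto_unique[OF L(1) lim]) (rule tendsto_eventually, rule ev, simp add: that)
  have "stationary_mean \<mu> T \<nu>"
  proof
    show "0 \<le> \<nu> A" for A
      by (rule tendsto_lowerbound[OF lim _ L(1)]) (rule ev, simp add: avg_nonneg)
    show "\<nu> UNIV = 1" by (rule ev_eq) (rule avg_UNIV)
    show "\<nu> (A \<union> B) = \<nu> A + \<nu> B" if "A \<inter> B = {}" for A B
    proof (rule tendsto_unique[OF L(1) lim])
      have "\<forall>\<^sub>F p in L. p A + p B = p (A \<union> B)"
        by (rule ev) (simp add: avg_Un[OF that])
      then show "((\<lambda>p. p (A \<union> B)) \<longlongrightarrow> \<nu> A + \<nu> B) L"
        by (rule Lim_transform_eventually[rotated]) (intro tendsto_add lim)
    qed
    show "\<nu> A = (\<integral>s. \<nu> (T s -` A) \<partial>measure_pmf \<mu>)" for A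
    proof -
      have "((\<lambda>p. \<integral>s. p (T s -` A) \<partial>measure_pmf \<mu>) \<longlongrightarrow> (\<integral>s. \<nu> (T s -` A) \<partial>measure_pmf \<mu>)) L"
        by (intro tendsto_integral_pmf lim ev) (simp add: avg_nonneg avg_le1)
      then have "((\<lambda>p. (\<integral>s. p (T s -` A) \<partial>measure_pmf \<mu>) - p A) \<longlongrightarrow> (\<integral>s. \<nu> (T s -` A) \<partial>measure_pmf \<mu>) - \<nu> A) L"
        by (intro tendsto_diff lim)
      moreover have "((\<lambda>p. (\<integral>s. p (T s -` A) \<partial>measure_pmf \<mu>) - p A) \<longlongrightarrow> 0) L"
      proof (rule tendstoI)
        fix e :: real assume "e > 0"
        then have "\<forall>\<^sub>F N in sequentially. 1 / real (Suc N) < e"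
          using order_tendstoD(2)[OF LIMSEQ_inverse_real_of_nat] by (simp add: inverse_eq_divide)
        then have "\<forall>\<^sub>F N in sequentially. \<bar>(\<integral>s. avg N (T s -` A) \<partial>measure_pmf \<mu>) - avg N A\<bar> < e"
          by eventually_elim (rule le_less_trans[OF avg_stat])
        then show "\<forall>\<^sub>F p in L. dist ((\<integral>s. p (T s -` A) \<partial>measure_pmf \<mu>) - p A) 0 < e"
          by (intro ev) (simp add: dist_real_def)
      qed
      ultimately have "(\<integral>s. \<nu> (T s -` A) \<partial>measure_pmf \<mu>) - \<nu> A = 0"
        by (rule tendsto_unique[OF L(1)])
      then show ?thesis by simp
    qed
  qed
  moreover have "\<nu> Y = 1" by (rule ev_eq) (rule avg_Y)
  ultimately show thesis by (rule that)
qed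

context stationary_mean
begin

lemma mean_mono: "A \<subseteq> B \<Longrightarrow> \<nu> A \<le> \<nu> B"
  using mean_Un[of A "B - A"] mean_nonneg[of "B - A"] by (simp add: Un_absorb1)

lemma mean_le_1: "\<nu> A \<le> 1"
  using mean_mono[of A UNIV] mean_UNIV by simp

lemma mean_Compl: "\<nu> (- A) = 1 - \<nu> A"
  using mean_Un[of A "- A"] mean_UNIV by simp

text \<open>Preimages under the action will be taken in the whole type; this cuts them back to the
  set that carries the mean.\<close>

lemma mean_Int_full:
  assumes "\<nu> Y = 1"
  shows "\<nu> (A \<inter> Y) = \<nu> A"
proof -
  have "\<nu> (A - Y) \<le> \<nu> (- Y)" by (rule mean_mono) auto
  then have "\<nu> (A - Y) = 0"
    using assms mean_nonneg[of "A - Y"] by (simp add: mean_Compl)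
  then show ?thesis
    using mean_Un[of "A \<inter> Y" "A - Y"] by (simp add: Int_Diff_disjoint Int_Diff_Un)
qed

end

section \<open>Countable bases of compact metrizable spaces\<close>

text \<open>For each \<open>n\<close> finitely many balls of radius \<open>inverse (Suc n)\<close>
  cover the space by total boundedness. All these balls together form a base.\<close>

lemma compact_metrizable_imp_second_countable:
  assumes "compact_space X" "metrizable_space X"
  shows "second_countable X"
proof -
  obtain M d where "Metric_space M d" and X: "X = Metric_space.mtopology M d"
    using assms(2) unfolding metrizable_space_def by blast
  interpret Metric_space M d by fact
  have "mtotally_bounded M"
    using assms(1) compactin_imp_mtotally_bounded unfolding X compact_space_def by simp
  then have "\<forall>n::nat. \<exists>K. finite K \<and> K \<subseteq> M \<and> M \<subseteq> (\<Union>x\<in>K. mball x (inverse (Suc n)))"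
    unfolding mtotally_bounded_def by simp
  then obtain K where K: "\<And>n::nat. finite (K n)" "\<And>n. K n \<subseteq> M" "\<And>n. M \<subseteq> (\<Union>x\<in>K n. mball x (inverse (Suc n)))"
    by metis
  define \<B> where "\<B> = (\<Union>n. (\<lambda>x. mball x (inverse (Suc n))) ` K n)"
  show ?thesis
    unfolding second_countable_def
  proof (intro exI conjI allI impI ballI)
    show "countable \<B>"
      unfolding \<B>_def using K(1) by (intro countable_UN countable_image) (auto intro: countable_finite)
    show "openin X V" if "V \<in> \<B>" for V
      using that by (auto simp: \<B>_def X)
    fix U x assume "openin X U \<and> x \<in> U"
    then obtain r where r: "r > 0" "mball x r \<subseteq> U" and xM: "x \<in> M"
      unfolding X openin_mtopology by blast
    obtain n where n: "inverse (real (Suc n)) < r / 2"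
      using reals_Archimedean[of "r / 2"] r by auto
    obtain y where y: "y \<in> K n" "x \<in> mball y (inverse (Suc n))"
      using K(3) xM by blast
    have "mball y (inverse (Suc n)) \<subseteq> mball x r"
    proof
      fix z assume z: "z \<in> mball y (inverse (Suc n))"
      have "d x z \<le> d x y + d y z" using y z by (intro triangle) auto
      then show "z \<in> mball x r"
        using y z n by (auto simp: commute[of x y])
    qed
    with y r show "\<exists>V\<in>\<B>. x \<in> V \<and> V \<subseteq> U"
      by (auto simp: \<B>_def)
  qed
qed

text \<open>Enumerate the base sets around \<open>x\<close>, with repetitions if there are finitely
  many, and intersect initial segments.\<close>

lemma second_countable_imp_shrinking_base:
  assumes "second_countable X" "x \<in> topspace X"
  obtains B :: "nat \<Rightarrow> 'a set" where "\<And>n. openin X (B n)" "\<And>n. x \<in> B n"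
    "\<And>U. openin X U \<Longrightarrow> x \<in> U \<Longrightarrow> \<forall>\<^sub>F n in sequentially. B n \<subseteq> U"
proof -
  obtain \<B> where \<B>: "countable \<B>" "\<And>V. V \<in> \<B> \<Longrightarrow> openin X V"
    "\<And>U x. openin X U \<Longrightarrow> x \<in> U \<Longrightarrow> \<exists>V\<in>\<B>. x \<in> V \<and> V \<subseteq> U"
    using assms(1) unfolding second_countable_def by metis
  define \<C> where "\<C> = {V \<in> \<B>. x \<in> V}"
  have \<C>: "countable \<C>" "\<C> \<noteq> {}"
    using \<B>(1) \<B>(3)[of "topspace X" x] assms(2) by (auto simp: \<C>_def)
  define B where "B n = (\<Inter>k\<le>n. from_nat_into \<C> k)" for n
  have in_\<C>: "from_nat_into \<C> k \<in> \<C>" for k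
    by (rule from_nat_into[OF \<C>(2)])
  show thesis
  proof (rule that[of B])
    show "openin X (B n)" for n
      unfolding B_def using in_\<C> \<B>(2) by (intro openin_Inter) (auto simp: \<C>_def)
    show "x \<in> B n" for n
      using in_\<C> by (auto simp: B_def \<C>_def)
    fix U assume U: "openin X U" "x \<in> U"
    then obtain V where V: "V \<in> \<C>" "V \<subseteq> U"
      using \<B>(3)[OF U] by (auto simp: \<C>_def)
    obtain k where k: "V = from_nat_into \<C> k"
      using from_nat_into_surj[OF \<C>(1) V(1)] by auto
    show "\<forall>\<^sub>F n in sequentially. B n \<subseteq> U"
      using eventually_ge_at_top[of k] by eventually_elim (use V k in \<open>auto simp: B_def\<close>)
  qed
qed

section \<open>Convergence groups\<close>

lemma AE_increments_in_support: "AE \<omega> in increments \<mu>. \<forall>n. \<omega> n \<in> set_pmf \<mu>"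
  unfolding increments_def AE_all_countable
  by (auto intro!: AE_PiM_component simp: measure_pmf.prob_space_axioms AE_measure_pmf_iff)

text \<open>The submonoid generated by \<open>S\<close>, as opposed to the subgroup: the elements
  that a walk with increments in \<open>S\<close> can reach from the identity.\<close>

inductive_set words :: "('g, 'b) monoid_scheme \<Rightarrow> 'g set \<Rightarrow> 'g set" for G and S where
  one: "\<one>\<^bsub>G\<^esub> \<in> words G S"
| snoc: "t \<in> words G S \<Longrightarrow> s \<in> S \<Longrightarrow> t \<otimes>\<^bsub>G\<^esub> s \<in> words G S"

lemma (in group) words_closed: "S \<subseteq> carrier G \<Longrightarrow> t \<in> words G S \<Longrightarrow> t \<in> carrier G"
  by (erule words.induct) auto

text \<open>A finite submonoid of a group is a subgroup.\<close>

lemma (in group) generate_subset_words: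
  assumes S: "S \<subseteq> carrier G" and fin: "finite (words G S)"
  shows "generate G S \<subseteq> words G S"
proof
  fix g assume "g \<in> generate G S"
  \<comment> \<open>Preservation of \<open>words G S\<close> by right multiplication with
    \<open>g\<close> passes to products of such \<open>g\<close>, and \<open>t\<close> equal to the
    identity yields membership at the end. For an inverse, right multiplication by \<open>s\<close>
    is an injection of a finite set into itself, hence onto, and can be undone there.\<close>
  then have "g \<in> carrier G \<and> (\<forall>t\<in>words G S. t \<otimes> g \<in> words G S)"
  proof (induction g rule: generate.induct)
    case one
    then show ?case using words_closed[OF S] by auto
  next
    case (incl s)
    then show ?case using S by (auto intro: words.snoc)
  next
    case (inv s)
    then have s: "s \<in> carrier G" using S by auto
    let ?R = "\<lambda>t. t \<otimes> s"
    have "inj_on ?R (words G S)"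
    proof (rule inj_onI)
      fix t u assume "t \<in> words G S" "u \<in> words G S" "t \<otimes> s = u \<otimes> s"
      then show "t = u" using words_closed[OF S] s by (metis right_cancel)
    qed
    moreover have "?R ` words G S \<subseteq> words G S"
      using words.snoc[OF _ inv, of _ G] by blast
    ultimately have onto: "?R ` words G S = words G S"
      by (intro endo_inj_surj[OF fin])
    have "t \<otimes> inv s \<in> words G S" if "t \<in> words G S" for t
    proof -
      from that have "t \<in> ?R ` words G S"
        by (simp only: onto)
      then obtain u where u: "u \<in> words G S" "t = u \<otimes> s"
        by (rule imageE)
      then have "t \<otimes> inv s = u"
        using words_closed[OF S u(1)] s by (simp add: m_assoc)
      with u show ?thesis by simp
    qed
    with s show ?case by simp
  next
    case (eng g h)
    then show ?case
      using words_closed[OF S] by (auto simp flip: m_assoc)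
  qed
  then show "g \<in> words G S"
    using words.one[of G S] by force
qed

text \<open>Each value occurs finitely often, so infinitely many values occur on \<open>I\<close>;
  one index is kept for each of them.\<close>

lemma infinite_injective_subsequence:
  fixes x :: "nat \<Rightarrow> 'a"
  assumes I: "infinite I" and fin: "\<And>y. finite {n. x n = y}"
  obtains r :: "nat \<Rightarrow> nat" where "strict_mono r" "range r \<subseteq> I" "inj (x \<circ> r)"
proof -
  define J where "J = inv_into I x ` (x ` I)"
  have "infinite (x ` I)"
  proof
    assume "finite (x ` I)"
    then have "finite (\<Union>y\<in>x ` I. {n. x n = y})"
      using fin by blast
    moreover have "I \<subseteq> (\<Union>y\<in>x ` I. {n. x n = y})" by auto
    ultimately show False using I finite_subset by blast
  qed
  then have "infinite J"
    unfolding J_def by (simp add: finite_image_iff inj_on_inv_into)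
  have J: "J \<subseteq> I" "inj_on x J"
    by (auto simp: J_def inv_into_into f_inv_into_f intro!: inj_onI)
  show thesis
  proof (rule that[of "enumerate J"])
    show "strict_mono (enumerate J)"
      using \<open>infinite J\<close> by (rule strict_mono_enumerate)
    show "range (enumerate J) \<subseteq> I"
      using range_enumerate[OF \<open>infinite J\<close>] J by simp
    show "inj (x \<circ> enumerate J)"
      using J(2) range_enumerate[OF \<open>infinite J\<close>] inj_enumerate[OF \<open>infinite J\<close>]
      by (intro comp_inj_on) auto
  qed
qed

section \<open>The action by homeomorphisms and attracting sequences\<close>

context convergence_group
begin

sublocale group G
  using group_hom group_hom.axioms(1) by auto

text \<open>The conclusion of the convergence property for the whole sequence: \<open>b\<close>
  attracts and \<open>a\<close> repels. The two points may coincide.\<close>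

definition attracting :: "(nat \<Rightarrow> 'g) \<Rightarrow> 'm \<Rightarrow> 'm \<Rightarrow> bool" where
  "attracting s a b \<longleftrightarrow>
    (\<forall>K U. compactin X K \<and> K \<subseteq> topspace X - {a} \<and> openin X U \<and> b \<in> U \<longrightarrow>
      (\<forall>\<^sub>F k in sequentially. \<phi> (s k) ` K \<subseteq> U))"

lemma attractingD:
  "attracting s a b \<Longrightarrow> compactin X K \<Longrightarrow> K \<subseteq> topspace X - {a} \<Longrightarrow> openin X U \<Longrightarrow> b \<in> U \<Longrightarrow>
    \<forall>\<^sub>F k in sequentially. \<phi> (s k) ` K \<subseteq> U"
  unfolding attracting_def by blast

lemma ex_attracting:
  fixes s :: "nat \<Rightarrow> 'g"
  assumes "inj s" "range s \<subseteq> carrier G"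
  obtains r a b where "strict_mono r" "a \<in> topspace X" "b \<in> topspace X" "attracting (s \<circ> r) a b"
  using convergence_property[OF assms] unfolding attracting_def by auto

lemma hausdorff: "Hausdorff_space X"
  using metrizable_space by (rule metrizable_imp_Hausdorff_space)

lemma action_closed: "g \<in> carrier G \<Longrightarrow> x \<in> topspace X \<Longrightarrow> \<phi> g x \<in> topspace X"
  using element_image by blast

lemma action_inv: "g \<in> carrier G \<Longrightarrow> x \<in> topspace X \<Longrightarrow> \<phi> g (\<phi> (inv g) x) = x"
  using composition_rule[of x g "inv g"] id_eq_one by (metis inv_closed r_inv restrict_apply')

lemma openin_action_image: "g \<in> carrier G \<Longrightarrow> openin X U \<Longrightarrow> openin X (\<phi> g ` U)"
  using homeomorphic_imp_open_map[OF homeomorphic_action] by (simp add: open_map_def)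

lemma openin_action_vimage: "g \<in> carrier G \<Longrightarrow> openin X U \<Longrightarrow> openin X (\<phi> g -` U \<inter> topspace X)"
  using openin_continuous_map_preimage[OF homeomorphic_imp_continuous_map[OF homeomorphic_action], of g U]
  by (simp add: vimage_def Int_def conj_commute)

lemma action_vimage_image:
  "g \<in> carrier G \<Longrightarrow> U \<subseteq> topspace X \<Longrightarrow> \<phi> g -` (\<phi> g ` U) \<inter> topspace X = U"
  using inj_prop[of g] by (auto dest: inj_onD)

lemma invariant_subset_generate:
  assumes gen: "generate G S = carrier G" and S: "S \<subseteq> carrier G" and A: "A \<subseteq> topspace X"
    and inv: "\<And>s. s \<in> S \<Longrightarrow> \<phi> s ` A = A"
  shows "invariant_subset G X \<phi> A"
proof -
  have comp: "\<phi> (g \<otimes> h) ` A = \<phi> g ` (\<phi> h ` A)" if "g \<in> carrier G" "h \<in> carrier G" for g h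
    unfolding image_image using A that by (intro image_cong refl) (auto intro!: composition_rule)
  have one: "\<phi> \<one> ` A = A"
    using A id_eq_one by (metis image_restrict_eq image_ident inf.absorb_iff2 image_cong restrict_apply' subsetD)
  have "\<phi> g ` A = A" if "g \<in> generate G S" for g
    using that
  proof (induction g rule: generate.induct)
    case one
    show ?case by fact
  next
    case (incl s)
    then show ?case by (rule inv)
  next
    case (inv s)
    then have "\<phi> (inv s) ` A = \<phi> (inv s) ` (\<phi> s ` A)"
      using assms(4) by simp
    also have "\<dots> = \<phi> (inv s \<otimes> s) ` A"
      using S inv by (subst comp) auto
    finally show ?case
      using S inv one by (auto simp: subset_iff)
  next
    case (eng g h)
    then show ?case using comp[of g h] gen by simp
  qed
  then show ?thesis
    using A gen by (auto simp: invariant_subset_def)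
qed

end

section \<open>Minimal non-elementary actions of infinite groups\<close>

locale minimal_convergence_group = convergence_group G X \<phi>
  for G :: "('g, 'b) monoid_scheme" (structure) and X :: "'m topology" and \<phi> :: "'g \<Rightarrow> 'm \<Rightarrow> 'm" +
  assumes infinite_group: "infinite (carrier G)"
    and nonempty_space: "topspace X \<noteq> {}"
    and non_elementary: "non_elementary G X \<phi>"
    and minimal: "minimal_action G X \<phi>"
begin

text \<open>A finite Hausdorff space is discrete, so some member of an attracting sequence maps the
  complement of \<open>a\<close> injectively into \<open>{b}\<close>. The space then has at most two
  points and is itself an invariant set of forbidden size.\<close>

lemma infinite_space: "infinite (topspace X)"
proof
  assume fin: "finite (topspace X)"
  obtain s :: "nat \<Rightarrow> 'g" where s: "inj s" "range s \<subseteq> carrier G"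
    using infinite_group infinite_countable_subset by blast
  obtain r a b where "strict_mono r" and r: "a \<in> topspace X" "b \<in> topspace X" "attracting (s \<circ> r) a b"
    by (rule ex_attracting[OF s])
  let ?K = "topspace X - {a}"
  have "openin X {b}"
  proof -
    have "closedin X (topspace X - {b})"
      by (rule closedin_Hausdorff_finite[OF hausdorff]) (use fin in auto)
    then show ?thesis using r(2) by (simp add: openin_closedin_eq)
  qed
  moreover have "compactin X ?K"
    by (rule finite_imp_compactin) (use fin in auto)
  ultimately have "\<forall>\<^sub>F k in sequentially. \<phi> ((s \<circ> r) k) ` ?K \<subseteq> {b}"
    by (intro attractingD[OF r(3)]) auto
  then obtain k where k: "\<phi> (s (r k)) ` ?K \<subseteq> {b}"
    by (auto simp: eventually_sequentially)
  have "inj_on (\<phi> (s (r k))) ?K"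
    using inj_prop[of "s (r k)"] s(2) by (auto intro: inj_on_subset)
  then have "card ?K \<le> card {b}"
    using k by (intro card_inj_on_le) auto
  then have "card (topspace X) \<le> 2"
    using r(1) fin by simp
  moreover have "card (topspace X) \<noteq> 0"
    using fin nonempty_space by simp
  ultimately have "card (topspace X) = 1 \<or> card (topspace X) = 2"
    by linarith
  moreover have "invariant_subset G X \<phi> (topspace X)"
    by (simp add: invariant_subset_def surj_prop)
  ultimately show False
    using non_elementary unfolding non_elementary_def by blast
qed

lemma finite_invariant_empty:
  assumes "invariant_subset G X \<phi> A" "finite A"
  shows "A = {}"
proof (rule ccontr)
  assume "A \<noteq> {}"
  have "A \<subseteq> topspace X" using assms(1) by (simp add: invariant_subset_def)
  then have "closedin X A"
    using assms(2) by (intro closedin_Hausdorff_finite hausdorff)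
  then have "A = topspace X"
    using minimal assms \<open>A \<noteq> {}\<close> unfolding minimal_action_def by blast
  then show False using infinite_space assms(2) by simp
qed

end

section \<open>A stationary mean has no atoms\<close>

locale stationary_action = minimal_convergence_group G X \<phi> + stationary_mean \<mu> \<phi> \<nu>
  for G :: "('g, 'b) monoid_scheme" (structure) and X :: "'m topology" and \<phi> :: "'g \<Rightarrow> 'm \<Rightarrow> 'm"
    and \<mu> :: "'g pmf" and \<nu> :: "'m set \<Rightarrow> real" +
  assumes generating: "generating_pmf G \<mu>"
    and mean_topspace: "\<nu> (topspace X) = 1"
begin

lemma support: "set_pmf \<mu> \<subseteq> carrier G"
  and generate_support: "generate G (set_pmf \<mu>) = carrier G"
  using generating by (auto simp: generating_pmf_def)

text \<open>An infimum over neighbourhoods instead of \<open>\<nu> {x}\<close>: a finitely additive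
  mean can concentrate near \<open>x\<close> without charging the point itself.\<close>

definition mass :: "'m \<Rightarrow> real" where
  "mass x = (INF U\<in>{U. openin X U \<and> x \<in> U}. \<nu> U)"

lemma bdd_below_mean: "bdd_below (\<nu> ` \<U>)"
  by (rule bdd_belowI2[of _ 0]) (rule mean_nonneg)

lemma mass_le: "openin X U \<Longrightarrow> x \<in> U \<Longrightarrow> mass x \<le> \<nu> U"
  unfolding mass_def by (rule cINF_lower[OF bdd_below_mean]) auto

lemma mass_nonneg: "x \<in> topspace X \<Longrightarrow> 0 \<le> mass x"
  unfolding mass_def using mean_nonneg by (intro cINF_greatest) auto

lemma mass_less:
  assumes "x \<in> topspace X" "mass x < c"
  obtains U where "openin X U" "x \<in> U" "\<nu> U < c"
  using assms(2) cINF_less_iff[OF _ bdd_below_mean, of "{U. openin X U \<and> x \<in> U}" c] assms(1)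
  unfolding mass_def by auto

lemma mass_le_1: "x \<in> topspace X \<Longrightarrow> mass x \<le> 1"
  using mass_le[of "topspace X" x] mean_topspace by simp

text \<open>Preimages under \<open>g\<close> of shrinking neighbourhoods of \<open>x\<close> are
  shrinking neighbourhoods of the preimage of \<open>x\<close>, up to points outside the
  space.\<close>

lemma tendsto_mass_translate:
  assumes g: "g \<in> carrier G" and x: "x \<in> topspace X"
    and B: "\<And>n. openin X (B n)" "\<And>n. x \<in> B n"
      "\<And>U. openin X U \<Longrightarrow> x \<in> U \<Longrightarrow> \<forall>\<^sub>F n in sequentially. B n \<subseteq> U"
  shows "(\<lambda>n. \<nu> (\<phi> g -` B n)) \<longlonglongrightarrow> mass (\<phi> (inv g) x)"
proof -
  let ?y = "\<phi> (inv g) x"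
  have y: "?y \<in> topspace X" "\<phi> g ?y = x"
    using g x action_inv by (auto intro: action_closed)
  show ?thesis
  proof (rule order_tendstoI)
    fix c assume c: "c < mass ?y"
    have "c < \<nu> (\<phi> g -` B n)" for n
    proof -
      have "mass ?y \<le> \<nu> (\<phi> g -` B n \<inter> topspace X)"
        using y B(2)[of n] by (intro mass_le openin_action_vimage g B) auto
      also have "\<dots> \<le> \<nu> (\<phi> g -` B n)"
        by (rule mean_mono) auto
      finally show ?thesis using c by simp
    qed
    then show "\<forall>\<^sub>F n in sequentially. c < \<nu> (\<phi> g -` B n)" by simp
  next
    fix c assume "mass ?y < c"
    then obtain V where V: "openin X V" "?y \<in> V" "\<nu> V < c"
      using mass_less y by metis
    have "\<forall>\<^sub>F n in sequentially. B n \<subseteq> \<phi> g ` V"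
      using V y by (intro B openin_action_image g) (auto simp: image_iff intro!: bexI[of _ ?y])
    then show "\<forall>\<^sub>F n in sequentially. \<nu> (\<phi> g -` B n) < c"
    proof eventually_elim
      case (elim n)
      have "\<nu> (\<phi> g -` B n) = \<nu> (\<phi> g -` B n \<inter> topspace X)"
        by (rule mean_Int_full[OF mean_topspace, symmetric])
      also have "\<dots> \<le> \<nu> V"
        using elim action_vimage_image[OF g openin_subset[OF V(1)]] by (intro mean_mono) auto
      finally show ?case using V(3) by simp
    qed
  qed
qed

text \<open>Stationarity writes the mean of \<open>B n\<close> as an average of the means of its
  preimages, which tend to masses as \<open>B n\<close> shrinks. The left side stays at least
  \<open>mass x\<close> throughout.\<close>

lemma mass_le_average:
  assumes x: "x \<in> topspace X"
  shows "mass x \<le> (\<integral>s. mass (\<phi> (inv s) x) \<partial>measure_pmf \<mu>)"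
proof -
  have "second_countable X"
    using compact_space metrizable_space by (rule compact_metrizable_imp_second_countable)
  then obtain B :: "nat \<Rightarrow> 'm set" where B: "\<And>n. openin X (B n)" "\<And>n. x \<in> B n"
    "\<And>U. openin X U \<Longrightarrow> x \<in> U \<Longrightarrow> \<forall>\<^sub>F n in sequentially. B n \<subseteq> U"
    using second_countable_imp_shrinking_base x by metis
  have "(\<lambda>n. \<integral>s. \<nu> (\<phi> s -` B n) \<partial>measure_pmf \<mu>) \<longlonglongrightarrow> (\<integral>s. mass (\<phi> (inv s) x) \<partial>measure_pmf \<mu>)"
    using support by (intro tendsto_integral_pmf tendsto_mass_translate x B) (auto simp: mean_nonneg mean_le_1)
  then show ?thesis
    by (rule LIMSEQ_le_const) (simp add: mean_stationary[symmetric] mass_le B)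
qed

text \<open>Hausdorff separation splits one point off the others by disjoint open sets, to which
  additivity applies.\<close>

lemma sum_mass_le:
  assumes "finite F" "openin X W" "F \<subseteq> W"
  shows "(\<Sum>x\<in>F. mass x) \<le> \<nu> W"
  using assms
proof (induction F arbitrary: W rule: finite_induct)
  case empty
  then show ?case by (simp add: mean_nonneg)
next
  case (insert x F)
  have sub: "insert x F \<subseteq> topspace X"
    using insert.prems openin_subset by blast
  obtain U V where UV: "openin X U" "openin X V" "{x} \<subseteq> U" "F \<subseteq> V" "disjnt U V"
    by (rule Hausdorff_space_compact_separation[OF hausdorff, of "{x}" F])
      (use insert sub in \<open>auto intro: finite_imp_compactin\<close>)
  have "mass x \<le> \<nu> (U \<inter> W)"
    using UV insert.prems by (intro mass_le openin_Int) auto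
  moreover have "(\<Sum>x\<in>F. mass x) \<le> \<nu> (V \<inter> W)"
    using UV insert.prems by (intro insert.IH openin_Int) auto
  moreover have "\<nu> (U \<inter> W) + \<nu> (V \<inter> W) \<le> \<nu> W"
    using UV(5) by (subst mean_Un[symmetric]) (auto simp: disjnt_def intro!: mean_mono)
  ultimately show ?case using insert by simp
qed

lemma finite_heavy:
  assumes "0 < c"
  shows "finite {x \<in> topspace X. c \<le> mass x}"
proof (rule ccontr)
  assume inf: "infinite {x \<in> topspace X. c \<le> mass x}"
  obtain n :: nat where n: "1 < real n * c"
    using reals_Archimedean3[OF assms] by blast
  obtain F where F: "finite F" "card F = n" "F \<subseteq> {x \<in> topspace X. c \<le> mass x}"
    using infinite_arbitrarily_large[OF inf] by blast
  have "real n * c = (\<Sum>x\<in>F. c)" using F by simp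
  also have "\<dots> \<le> (\<Sum>x\<in>F. mass x)" using F by (intro sum_mono) auto
  also have "\<dots> \<le> \<nu> (topspace X)" using F by (intro sum_mass_le) auto
  finally show False using n mean_topspace by simp
qed

text \<open>A maximum principle. At a point of maximal mass, \<open>mass_le_average\<close> forces
  all its images under inverses of the support to have maximal mass as well. A finite set mapped
  into itself by these bijections is permuted by them, hence invariant, which minimality
  excludes.\<close>

lemma mass_zero:
  assumes "x \<in> topspace X"
  shows "mass x = 0"
proof (rule ccontr)
  assume "mass x \<noteq> 0"
  then have pos: "0 < mass x" using mass_nonneg[OF assms] by simp
  \<comment> \<open>Only finitely many points are at least as heavy as \<open>x\<close>, so the
    supremum of the mass is attained.\<close>
  define H where "H = {y \<in> topspace X. mass x \<le> mass y}"
  have H: "finite H" "x \<in> H"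
    unfolding H_def using finite_heavy[OF pos] assms by auto
  define m where "m = Max (mass ` H)"
  have m: "mass y \<le> m" if "y \<in> topspace X" for y
  proof (cases "y \<in> H")
    case True
    then show ?thesis unfolding m_def using H by simp
  next
    case False
    then have "mass y \<le> mass x" using that by (simp add: H_def)
    also have "\<dots> \<le> m" unfolding m_def using H by simp
    finally show ?thesis .
  qed
  define A where "A = {y \<in> topspace X. mass y = m}"
  have "m \<in> mass ` H"
    unfolding m_def using H by (intro Max_in) auto
  then have "A \<noteq> {}" by (auto simp: A_def H_def)
  have "mass x \<le> m" using m assms by simp
  then have "A \<subseteq> H" by (auto simp: A_def H_def)
  then have "finite A" using H finite_subset by blast
  have closed: "\<phi> (inv s) y \<in> A" if s: "s \<in> set_pmf \<mu>" and y: "y \<in> A" for s y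
  proof -
    have yX: "y \<in> topspace X" "mass y = m" using y by (auto simp: A_def)
    have inX: "\<phi> (inv t) y \<in> topspace X" if "t \<in> set_pmf \<mu>" for t
      using that support yX by (intro action_closed) auto
    have int: "integrable (measure_pmf \<mu>) (\<lambda>t. mass (\<phi> (inv t) y))"
      using mass_le_1[OF inX] mass_nonneg[OF inX]
      by (intro measure_pmf.integrable_const_bound[where B = 1]) (auto simp: AE_measure_pmf_iff)
    then have int': "integrable (measure_pmf \<mu>) (\<lambda>t. m - mass (\<phi> (inv t) y))"
      by auto
    have nonneg: "AE t in measure_pmf \<mu>. 0 \<le> m - mass (\<phi> (inv t) y)"
      using m[OF inX] by (simp add: AE_measure_pmf_iff)
    have "(\<integral>t. m - mass (\<phi> (inv t) y) \<partial>measure_pmf \<mu>) = m - (\<integral>t. mass (\<phi> (inv t) y) \<partial>measure_pmf \<mu>)"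
      using int by simp
    also have "\<dots> \<le> 0" using mass_le_average[OF yX(1)] yX(2) by simp
    finally have "(\<integral>t. m - mass (\<phi> (inv t) y) \<partial>measure_pmf \<mu>) = 0"
      using integral_nonneg_AE[OF nonneg] by simp
    then have "AE t in measure_pmf \<mu>. m - mass (\<phi> (inv t) y) = 0"
      using integral_nonneg_eq_0_iff_AE[OF int' nonneg] by simp
    then show ?thesis
      using s inX[OF s] by (auto simp: AE_measure_pmf_iff A_def)
  qed
  have "\<phi> s ` A = A" if s: "s \<in> set_pmf \<mu>" for s
  proof -
    have sG: "s \<in> carrier G" using s support by auto
    have "inj_on (\<phi> (inv s)) A"
      using inj_prop[of "inv s"] sG by (auto simp: A_def intro: inj_on_subset)
    then have "\<phi> (inv s) ` A = A"
      using \<open>finite A\<close> closed[OF s] by (intro endo_inj_surj) auto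
    then have "\<phi> s ` A = \<phi> s ` (\<phi> (inv s) ` A)" by simp
    also have "\<dots> = A"
      unfolding image_image using action_inv[OF sG] by (auto simp: A_def)
    finally show ?thesis .
  qed
  then have "invariant_subset G X \<phi> A"
    by (intro invariant_subset_generate[OF generate_support support]) (auto simp: A_def)
  then show False
    using finite_invariant_empty \<open>finite A\<close> \<open>A \<noteq> {}\<close> by blast
qed

lemma small_neighbourhood:
  assumes "x \<in> topspace X" "0 < e"
  obtains U where "openin X U" "x \<in> U" "\<nu> U < e"
  using mass_less[OF assms(1)] mass_zero[OF assms(1)] assms(2) by metis

text \<open>Cut out a neighbourhood of the repelling point of mean below \<open>1 - c\<close>; the
  compact remainder is eventually moved into \<open>U\<close>.\<close>

lemma attracting_mean:
  assumes s: "range s \<subseteq> carrier G" and att: "attracting s a b" and a: "a \<in> topspace X"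
    and U: "openin X U" "b \<in> U"
  shows "(\<lambda>k. \<nu> (\<phi> (s k) -` U)) \<longlonglongrightarrow> 1"
proof (rule order_tendstoI)
  fix c :: real assume "c < 1"
  then obtain V where V: "openin X V" "a \<in> V" "\<nu> V < 1 - c"
    using small_neighbourhood[OF a, of "1 - c"] by auto
  let ?K = "topspace X - V"
  have "compactin X ?K"
    using compact_space V(1) by (intro closedin_compact_space) auto
  then have "\<forall>\<^sub>F k in sequentially. \<phi> (s k) ` ?K \<subseteq> U"
    using att V U by (intro attractingD) auto
  then show "\<forall>\<^sub>F k in sequentially. c < \<nu> (\<phi> (s k) -` U)"
  proof eventually_elim
    case (elim k)
    have "c < \<nu> (- V)" using V(3) by (simp add: mean_Compl)
    also have "\<dots> = \<nu> (- V \<inter> topspace X)" by (rule mean_Int_full[OF mean_topspace, symmetric])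
    also have "\<dots> \<le> \<nu> (\<phi> (s k) -` U)" using elim by (intro mean_mono) auto
    finally show ?case .
  qed
next
  fix c :: real assume "1 < c"
  then show "\<forall>\<^sub>F k in sequentially. \<nu> (\<phi> (s k) -` U) < c"
    by (intro always_eventually allI le_less_trans[OF mean_le_1])
qed

section \<open>Harmonic functions on the group and transience of the walk\<close>

lemma mean_translate_harmonic:
  assumes g: "g \<in> carrier G"
  shows "(\<integral>s. \<nu> (\<phi> (g \<otimes> s) -` A) \<partial>measure_pmf \<mu>) = \<nu> (\<phi> g -` A)"
proof -
  have "\<nu> (\<phi> (g \<otimes> s) -` A) = \<nu> (\<phi> s -` (\<phi> g -` A))" if "s \<in> set_pmf \<mu>" for s
  proof -
    have "\<phi> (g \<otimes> s) -` A \<inter> topspace X = \<phi> s -` (\<phi> g -` A) \<inter> topspace X"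
      using that support g composition_rule by auto
    then show ?thesis using mean_Int_full[OF mean_topspace] by metis
  qed
  then have "(\<integral>s. \<nu> (\<phi> (g \<otimes> s) -` A) \<partial>measure_pmf \<mu>) = (\<integral>s. \<nu> (\<phi> s -` (\<phi> g -` A)) \<partial>measure_pmf \<mu>)"
    by (intro integral_cong_AE) (auto simp: AE_measure_pmf_iff)
  then show ?thesis by (simp add: mean_stationary[symmetric])
qed

text \<open>Letters outside the group have probability 0; letting them leave the state unchanged
  keeps every path in the group.\<close>

definition walk_step :: "'g \<Rightarrow> 'g \<Rightarrow> 'g" where
  "walk_step g s = (if s \<in> carrier G then g \<otimes> s else g)"

sublocale walk: random_iteration "carrier G" walk_step \<mu>
  using countable_group by unfold_locales (auto simp: walk_step_def)

lemma walk_step_support: "s \<in> set_pmf \<mu> \<Longrightarrow> walk_step g s = g \<otimes> s"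
  using support by (auto simp: walk_step_def)

lemma walk_harmonic:
  assumes "g \<in> carrier G"
  shows "(\<integral>s. \<nu> (\<phi> (walk_step g s) -` A) \<partial>measure_pmf \<mu>) = \<nu> (\<phi> g -` A)"
proof -
  have "(\<integral>s. \<nu> (\<phi> (walk_step g s) -` A) \<partial>measure_pmf \<mu>) = (\<integral>s. \<nu> (\<phi> (g \<otimes> s) -` A) \<partial>measure_pmf \<mu>)"
    by (intro integral_cong_AE) (auto simp: AE_measure_pmf_iff walk_step_support)
  then show ?thesis using mean_translate_harmonic[OF assms] by simp
qed

text \<open>The variance of one increment, started at \<open>g\<close>, of the harmonic function
  given by the mean of the translated set \<open>A\<close>.\<close>

definition energy :: "'m set \<Rightarrow> 'g \<Rightarrow> real" where
  "energy A g = (\<integral>s. (\<nu> (\<phi> (walk_step g s) -` A) - \<nu> (\<phi> g -` A))\<^sup>2 \<partial>measure_pmf \<mu>)"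

lemma energy_nonneg: "0 \<le> energy A g"
  by (simp add: energy_def)

lemma energy_zero:
  assumes "energy A g = 0" "s \<in> set_pmf \<mu>"
  shows "\<nu> (\<phi> (g \<otimes> s) -` A) = \<nu> (\<phi> g -` A)"
proof -
  have "integrable (measure_pmf \<mu>) (\<lambda>s. (\<nu> (\<phi> (walk_step g s) -` A) - \<nu> (\<phi> g -` A))\<^sup>2)"
  proof (rule measure_pmf.integrable_const_bound[where B = 1])
    have "\<bar>\<nu> B - \<nu> C\<bar> \<le> 1" for B C
      using mean_nonneg[of B] mean_nonneg[of C] mean_le_1[of B] mean_le_1[of C] by linarith
    then have "(\<nu> B - \<nu> C)\<^sup>2 \<le> 1" for B C
      by (simp add: abs_square_le_1)
    then show "AE s in measure_pmf \<mu>. norm ((\<nu> (\<phi> (walk_step g s) -` A) - \<nu> (\<phi> g -` A))\<^sup>2) \<le> 1"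
      by simp
  qed simp
  then have "AE s in measure_pmf \<mu>. (\<nu> (\<phi> (walk_step g s) -` A) - \<nu> (\<phi> g -` A))\<^sup>2 = 0"
    using assms(1) unfolding energy_def by (subst (asm) integral_nonneg_eq_0_iff_AE) auto
  then show ?thesis
    using assms(2) walk_step_support by (auto simp: AE_measure_pmf_iff)
qed

lemma infinite_words: "infinite (words G (set_pmf \<mu>))"
proof
  assume fin: "finite (words G (set_pmf \<mu>))"
  have "carrier G \<subseteq> words G (set_pmf \<mu>)"
    using generate_subset_words[OF support fin] by (simp add: generate_support)
  then show False
    using fin infinite_group by (simp add: finite_subset)
qed

text \<open>Otherwise \<open>g \<nu>\<close> would be equal to \<open>g t \<nu>\<close> for infinitely many \<open>t\<close>, and therefore to
  a point mass.\<close>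

lemma ex_positive_energy:
  assumes g: "g \<in> carrier G"
  obtains t A where "t \<in> words G (set_pmf \<mu>)" "0 < energy A (g \<otimes> t)"
proof (rule ccontr)
  assume "\<not> thesis"
  with that have zero: "energy A (g \<otimes> t) = 0" if "t \<in> words G (set_pmf \<mu>)" for t A
    using energy_nonneg[of A "g \<otimes> t"] \<open>t \<in> words G (set_pmf \<mu>)\<close> by (metis order_le_less)
  \<comment> \<open>Zero energy means that no step of positive probability changes the harmonic
    function, so it is constant along all words.\<close>
  have const: "\<nu> (\<phi> (g \<otimes> t) -` A) = \<nu> (\<phi> g -` A)" if "t \<in> words G (set_pmf \<mu>)" for t A
    using that
  proof (induction t rule: words.induct)
    case one
    then show ?case using g by simp
  next
    case (snoc t s)
    have "g \<otimes> (t \<otimes> s) = (g \<otimes> t) \<otimes> s"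
      using g words_closed[OF support snoc(1)] support snoc(2) by (auto simp: m_assoc)
    then show ?case
      using energy_zero[OF zero[OF snoc(1)] snoc(2)] snoc by simp
  qed
  obtain t :: "nat \<Rightarrow> 'g" where t: "inj t" "range t \<subseteq> words G (set_pmf \<mu>)"
    using infinite_words infinite_countable_subset by blast
  have tG: "t n \<in> carrier G" for n using t words_closed[OF support] by auto
  have "inj (\<lambda>n. g \<otimes> t n)"
    using t(1) tG g by (auto simp: inj_def)
  moreover have "range (\<lambda>n. g \<otimes> t n) \<subseteq> carrier G"
    using tG g by auto
  ultimately obtain r a b where "strict_mono r"
    and r: "a \<in> topspace X" "b \<in> topspace X" "attracting ((\<lambda>n. g \<otimes> t n) \<circ> r) a b"
    by (rule ex_attracting)
  let ?y = "\<phi> (inv g) b"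
  have y: "?y \<in> topspace X" "\<phi> g ?y = b"
    using g r action_inv by (auto intro: action_closed)
  \<comment> \<open>The image of \<open>V\<close> under \<open>g\<close> is a neighbourhood of
    \<open>b\<close>, so its preimages along the attracting sequence have means tending to 1, while
    \<open>const\<close> keeps these means equal to \<open>\<nu> V < 1\<close>.\<close>
  obtain V where V: "openin X V" "?y \<in> V" "\<nu> V < 1"
    using small_neighbourhood[OF y(1), of 1] by auto
  have "(\<lambda>k. \<nu> (\<phi> (((\<lambda>n. g \<otimes> t n) \<circ> r) k) -` (\<phi> g ` V))) \<longlonglongrightarrow> 1"
    using V y tG g r(1)
    by (intro attracting_mean[OF _ r(3)] openin_action_image) (auto simp: image_iff intro!: bexI[of _ ?y])
  then have "(\<lambda>k. \<nu> (\<phi> g -` (\<phi> g ` V))) \<longlonglongrightarrow> 1"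
    using const t(2) by (simp add: image_subset_iff)
  then have "\<nu> (\<phi> g -` (\<phi> g ` V)) = 1"
    by (simp add: LIMSEQ_const_iff)
  moreover have "\<nu> (\<phi> g -` (\<phi> g ` V)) = \<nu> V"
    using mean_Int_full[OF mean_topspace, of "\<phi> g -` (\<phi> g ` V)"] action_vimage_image[OF g openin_subset[OF V(1)]]
    by simp
  ultimately show False using V(3) by simp
qed

text \<open>At a state \<open>g \<otimes> t\<close> of positive energy the indicator is at most a
  multiple of the energy, whose potential is bounded by \<open>green_energy\<close>. Finiteness
  travels back along the word \<open>t\<close>: each visit to a state is followed by the letter
  \<open>s\<close> with probability \<open>pmf \<mu> s > 0\<close>, so infinitely many expected
  visits would persist at the next state.\<close>

lemma green_finite:
  assumes g: "g \<in> carrier G"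
  shows "walk.green \<one> (indicator {g}) < \<infinity>"
proof -
  obtain t A where t: "t \<in> words G (set_pmf \<mu>)" and pos: "0 < energy A (g \<otimes> t)"
    using ex_positive_energy[OF g] .
  have "walk.green \<one> (indicator {g \<otimes> t}) \<le> walk.green \<one> (\<lambda>y. ennreal (1 / energy A (g \<otimes> t)) * ennreal (energy A y))"
    using pos by (intro walk.green_mono) (auto simp: indicator_def simp flip: ennreal_mult')
  also have "\<dots> = ennreal (1 / energy A (g \<otimes> t)) * walk.green \<one> (\<lambda>y. ennreal (energy A y))"
    by (rule walk.green_cmult)
  also have "walk.green \<one> (\<lambda>y. ennreal (energy A y)) \<le> 1"
    unfolding energy_def by (rule walk.green_energy) (auto simp: mean_nonneg mean_le_1 walk_harmonic)
  then have "ennreal (1 / energy A (g \<otimes> t)) * walk.green \<one> (\<lambda>y. ennreal (energy A y)) < \<infinity>"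
    by (auto simp: ennreal_mult_less_top intro: le_less_trans)
  finally have "walk.green \<one> (indicator {g \<otimes> t}) < \<infinity>" .
  with t show ?thesis
  proof (induction t rule: words.induct)
    case one
    then show ?case using g by simp
  next
    case (snoc t s)
    have tG: "t \<in> carrier G" using words_closed[OF support snoc(1)] .
    have sG: "s \<in> carrier G" using snoc(2) support by auto
    let ?x = "g \<otimes> t"
    have "ennreal (pmf \<mu> s) * indicator {?x} y \<le> walk.transition (indicator {g \<otimes> (t \<otimes> s)}) y" for y
    proof (cases "y = ?x")
      case True
      have "ennreal (pmf \<mu> s) = (\<integral>\<^sup>+ u. indicator {s} u \<partial>measure_pmf \<mu>)"
        by (simp add: emeasure_pmf_single)
      also have "\<dots> \<le> walk.transition (indicator {g \<otimes> (t \<otimes> s)}) ?x"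
        unfolding walk.transition_def using g tG sG
        by (intro nn_integral_mono) (auto simp: indicator_def walk_step_def m_assoc)
      finally show ?thesis using True by simp
    qed simp
    then have "walk.green \<one> (\<lambda>y. ennreal (pmf \<mu> s) * indicator {?x} y)
        \<le> walk.green \<one> (walk.transition (indicator {g \<otimes> (t \<otimes> s)}))"
      by (intro walk.green_mono) auto
    also have "\<dots> \<le> walk.green \<one> (indicator {g \<otimes> (t \<otimes> s)})"
      by (rule walk.green_transition)
    also have "\<dots> < \<infinity>" by (rule snoc.prems)
    finally have "ennreal (pmf \<mu> s) * walk.green \<one> (indicator {?x}) < \<infinity>"
      by (simp add: walk.green_cmult)
    moreover have "ennreal (pmf \<mu> s) \<noteq> 0"
      using snoc(2) by (simp add: set_pmf_iff pmf_pos ennreal_eq_0_iff not_le)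
    ultimately have "walk.green \<one> (indicator {?x}) < \<infinity>"
      by (auto simp: ennreal_mult_less_top)
    then show ?case by (rule snoc.IH)
  qed
qed

lemma AE_transient: "AE \<omega> in increments \<mu>. \<forall>g\<in>carrier G. finite {n. walk.path \<one> \<omega> n = g}"
  unfolding increments_def AE_ball_countable[OF countable_group]
proof
  fix g assume "g \<in> carrier G"
  then show "AE \<omega> in walk.S.S. finite {n. walk.path \<one> \<omega> n = g}"
    using green_finite by (intro walk.AE_finitely_many_visits one_closed) (simp add: walk.green_def)
qed

lemma AE_mean_convergent:
  assumes "countable \<A>"
  shows "AE \<omega> in increments \<mu>. \<forall>A\<in>\<A>. convergent (\<lambda>n. \<nu> (\<phi> (walk.path \<one> \<omega> n) -` A))"
  unfolding increments_def AE_ball_countable[OF assms]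
  by (intro ballI walk.AE_harmonic_convergent one_closed mean_nonneg mean_le_1 walk_harmonic)

lemma AE_path_eq_random_walk:
  "AE \<omega> in increments \<mu>. walk.path \<one> \<omega> = random_walk G \<omega>"
  using AE_increments_in_support[of \<mu>]
proof eventually_elim
  case (elim \<omega>)
  have "walk.path \<one> \<omega> n = random_walk G \<omega> n" for n
    using elim by (induction n) (auto simp: walk_step_support)
  then show ?case by auto
qed

end

section \<open>Closeness of group elements to open sets\<close>

context convergence_group
begin

text \<open>The exceptional \<open>a\<close> absorbs a repelling point that happens to lie in
  \<open>P\<close>. It ranges over the whole type, so there may also be no exception within
  \<open>P\<close>.\<close>

definition halo :: "'m set \<Rightarrow> 'm set \<Rightarrow> 'g set" where
  "halo P U = {g \<in> carrier G. \<exists>a. \<forall>p\<in>P - {a}. \<phi> g p \<in> U}"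

lemma halo_Int_subset: "halo P (U \<inter> V) \<subseteq> halo P U \<inter> halo P V"
  by (auto simp: halo_def)

text \<open>Two exceptions cannot exhaust three points, and the image of a remaining point would lie
  in both \<open>U\<close> and \<open>V\<close>.\<close>

lemma halo_disjoint:
  assumes "card P = 3" "U \<inter> V = {}"
  shows "halo P U \<inter> halo P V = {}"
proof (rule ccontr)
  assume "halo P U \<inter> halo P V \<noteq> {}"
  then obtain g a b where "\<forall>p\<in>P - {a}. \<phi> g p \<in> U" "\<forall>p\<in>P - {b}. \<phi> g p \<in> V"
    by (auto simp: halo_def)
  then have "P \<subseteq> {a, b}" using assms(2) by auto
  then have "card P \<le> card {a, b}" by (intro card_mono) auto
  also have "\<dots> \<le> 2" by (simp add: card_insert_if)
  finally show False using assms(1) by simp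
qed

text \<open>\<open>P - {a}\<close> is finite, hence a compact set avoiding the repelling point, and
  \<open>a\<close> is the permitted exception.\<close>

lemma attracting_halo:
  assumes "finite P" "P \<subseteq> topspace X" "range s \<subseteq> carrier G" "attracting s a b" "openin X U" "b \<in> U"
  shows "\<forall>\<^sub>F k in sequentially. s k \<in> halo P U"
proof -
  have "\<forall>\<^sub>F k in sequentially. \<phi> (s k) ` (P - {a}) \<subseteq> U"
    using assms by (intro attractingD[OF assms(4)] finite_imp_compactin) auto
  then show ?thesis
    by eventually_elim (use assms(3) in \<open>auto simp: halo_def\<close>)
qed

end

section \<open>Convergence of almost every path\<close>

context stationary_action
begin

text \<open>For a base set \<open>A\<close> around \<open>b\<close>, separated from a neighbourhood
  \<open>V\<close> of \<open>b'\<close>, the convergent means of the preimages of \<open>A\<close>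
  tend to 1 along \<open>r\<close>, hence also along \<open>r'\<close>. There the means of the
  preimages of \<open>V\<close> tend to 1 too, but these preimages are disjoint from those of
  \<open>A\<close>.\<close>

lemma attractor_unique:
  fixes w :: "nat \<Rightarrow> 'g"
  assumes w: "\<And>n. w n \<in> carrier G"
    and base: "\<And>U x. openin X U \<Longrightarrow> x \<in> U \<Longrightarrow> \<exists>V\<in>\<B>. openin X V \<and> x \<in> V \<and> V \<subseteq> U"
    and conv: "\<And>A. A \<in> \<B> \<Longrightarrow> convergent (\<lambda>n. \<nu> (\<phi> (w n) -` A))"
    and r: "strict_mono r" "a \<in> topspace X" "b \<in> topspace X" "attracting (w \<circ> r) a b"
    and r': "strict_mono r'" "a' \<in> topspace X" "b' \<in> topspace X" "attracting (w \<circ> r') a' b'"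
  shows "b = b'"
proof (rule ccontr)
  assume "b \<noteq> b'"
  then obtain U V where UV: "openin X U" "openin X V" "b \<in> U" "b' \<in> V" "disjnt U V"
    using hausdorff r(3) r'(3) unfolding Hausdorff_space_def by metis
  obtain A where A: "A \<in> \<B>" "openin X A" "b \<in> A" "A \<subseteq> U"
    using base[OF UV(1,3)] by blast
  obtain l where l: "(\<lambda>n. \<nu> (\<phi> (w n) -` A)) \<longlonglongrightarrow> l"
    using conv[OF A(1)] by (auto simp: convergent_def)
  have "(\<lambda>k. \<nu> (\<phi> ((w \<circ> r) k) -` A)) \<longlonglongrightarrow> 1"
    using w r(2) A by (intro attracting_mean[OF _ r(4)]) auto
  then have "l = 1"
    using LIMSEQ_unique[OF LIMSEQ_subseq_LIMSEQ[OF l r(1)]] by (simp add: o_def)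
  have "(\<lambda>k. \<nu> (\<phi> ((w \<circ> r') k) -` V)) \<longlonglongrightarrow> 1"
    using w r'(2) UV by (intro attracting_mean[OF _ r'(4)]) auto
  moreover have "(\<lambda>k. \<nu> (\<phi> ((w \<circ> r') k) -` A)) \<longlonglongrightarrow> 1"
    using LIMSEQ_subseq_LIMSEQ[OF l r'(1)] \<open>l = 1\<close> by (simp add: o_def)
  ultimately have "(\<lambda>k. \<nu> (\<phi> ((w \<circ> r') k) -` V) + \<nu> (\<phi> ((w \<circ> r') k) -` A)) \<longlonglongrightarrow> 1 + 1"
    by (rule tendsto_add)
  moreover have "\<nu> (\<phi> g -` V) + \<nu> (\<phi> g -` A) \<le> 1" for g
  proof -
    have "\<phi> g -` V \<inter> \<phi> g -` A = {}" using UV(5) A(4) by (auto simp: disjnt_def)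
    then show ?thesis using mean_Un mean_le_1 by metis
  qed
  ultimately have "1 + 1 \<le> (1::real)"
    by (intro LIMSEQ_le_const2) auto
  then show False by simp
qed

text \<open>Every infinite set of times contains an attracting subsequence, and all these share one
  attracting point \<open>b\<close>. Infinitely many times outside a halo of a neighbourhood of
  \<open>b\<close> would contain such a subsequence, which must enter that halo.\<close>

lemma ex_limit_of_transient_path:
  fixes w :: "nat \<Rightarrow> 'g"
  assumes w: "\<And>n. w n \<in> carrier G"
    and transient: "\<And>g. finite {n. w n = g}"
    and base: "\<And>U x. openin X U \<Longrightarrow> x \<in> U \<Longrightarrow> \<exists>V\<in>\<B>. openin X V \<and> x \<in> V \<and> V \<subseteq> U"
    and conv: "\<And>A. A \<in> \<B> \<Longrightarrow> convergent (\<lambda>n. \<nu> (\<phi> (w n) -` A))"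
    and P: "finite P" "P \<subseteq> topspace X"
  shows "\<exists>x\<in>topspace X. \<forall>U. openin X U \<longrightarrow> x \<in> U \<longrightarrow> (\<forall>\<^sub>F n in sequentially. w n \<in> halo P U)"
proof -
  have accumulate: "\<exists>(r :: nat \<Rightarrow> nat) a b. strict_mono r \<and> range r \<subseteq> I \<and> a \<in> topspace X \<and> b \<in> topspace X \<and> attracting (w \<circ> r) a b"
    if I: "infinite I" for I
  proof -
    obtain r :: "nat \<Rightarrow> nat" where r: "strict_mono r" "range r \<subseteq> I" "inj (w \<circ> r)"
      by (rule infinite_injective_subsequence[OF I transient])
    have "range (w \<circ> r) \<subseteq> carrier G" using w by auto
    then obtain q a b where q: "strict_mono q" "a \<in> topspace X" "b \<in> topspace X" "attracting ((w \<circ> r) \<circ> q) a b"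
      by (rule ex_attracting[OF r(3)])
    have "strict_mono (r \<circ> q)" "range (r \<circ> q) \<subseteq> I"
      using r q by (auto intro: strict_mono_o)
    with q show ?thesis unfolding o_assoc[symmetric] by blast
  qed
  obtain r :: "nat \<Rightarrow> nat" and a b where r: "strict_mono r" "a \<in> topspace X" "b \<in> topspace X" "attracting (w \<circ> r) a b"
    using accumulate[OF infinite_UNIV_nat] by blast
  show ?thesis
  proof (intro bexI[OF _ r(3)] allI impI)
    fix U assume U: "openin X U" "b \<in> U"
    show "\<forall>\<^sub>F n in sequentially. w n \<in> halo P U"
    proof (rule ccontr)
      assume "\<not> (\<forall>\<^sub>F n in sequentially. w n \<in> halo P U)"
      then have "infinite {n. w n \<notin> halo P U}"
        by (simp add: cofinite_eq_sequentially[symmetric] eventually_cofinite)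
      from accumulate[OF this] obtain r' :: "nat \<Rightarrow> nat" and a' b' where r': "strict_mono r'" "range r' \<subseteq> {n. w n \<notin> halo P U}"
        "a' \<in> topspace X" "b' \<in> topspace X" "attracting (w \<circ> r') a' b'"
        by blast
      have "b = b'"
        using attractor_unique[OF w base conv r r'(1,3-5)] .
      then have "\<forall>\<^sub>F k in sequentially. (w \<circ> r') k \<in> halo P U"
        using U w by (intro attracting_halo[OF P _ r'(5)]) auto
      then have "\<exists>k. (w \<circ> r') k \<in> halo P U"
        by (auto simp: eventually_sequentially)
      then show False using r'(2) by auto
    qed
  qed
qed

end

lemma (in group) random_walk_closed: "(\<And>n. \<omega> n \<in> carrier G) \<Longrightarrow> random_walk G \<omega> n \<in> carrier G"
  by (induction n) auto

text \<open>Finiteness of \<open>halo P U - A\<close> is the relation \<open>near U A\<close> of the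
  compactification below. Transience makes the walk leave this finite set forever, so entering the
  halo means entering \<open>A\<close>.\<close>

lemma (in minimal_convergence_group) AE_random_walk_converges:
  assumes \<mu>: "generating_pmf G \<mu>" and P: "finite P" "P \<subseteq> topspace X"
  shows "AE \<omega> in increments \<mu>. \<exists>x\<in>topspace X. \<forall>U A. openin X U \<and> x \<in> U \<and> finite (halo P U - A) \<longrightarrow>
    (\<forall>\<^sub>F n in sequentially. random_walk G \<omega> n \<in> A)"
proof -
  have supp: "set_pmf \<mu> \<subseteq> carrier G" using \<mu> by (simp add: generating_pmf_def)
  obtain x0 where "x0 \<in> topspace X" using nonempty_space by blast
  then obtain \<nu> where \<nu>: "stationary_mean \<mu> \<phi> \<nu>" "\<nu> (topspace X) = 1"
    by (rule ex_stationary_mean[where \<mu> = \<mu> and T = \<phi>]) (use supp in \<open>auto intro: action_closed\<close>)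
  interpret stationary_mean \<mu> \<phi> \<nu> by (rule \<nu>(1))
  interpret stationary_action G X \<phi> \<mu> \<nu>
    by unfold_locales (use \<mu> \<nu>(2) in auto)
  have "second_countable X"
    using compact_space metrizable_space by (rule compact_metrizable_imp_second_countable)
  then obtain \<B> where \<B>: "countable \<B>" "\<And>V. V \<in> \<B> \<Longrightarrow> openin X V"
    "\<And>U x. openin X U \<Longrightarrow> x \<in> U \<Longrightarrow> \<exists>V\<in>\<B>. x \<in> V \<and> V \<subseteq> U"
    unfolding second_countable_def by metis
  from AE_transient AE_mean_convergent[OF \<B>(1)] AE_path_eq_random_walk AE_increments_in_support[of \<mu>]
  show ?thesis
  proof eventually_elim
    case (elim \<omega>)
    let ?w = "random_walk G \<omega>"
    have w: "?w n \<in> carrier G" for n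
      using elim(4) supp by (intro random_walk_closed) auto
    have transient: "finite {n. ?w n = g}" for g
    proof (cases "g \<in> carrier G")
      case True
      then show ?thesis using elim(1,3) by simp
    next
      case False
      then have "{n. ?w n = g} = {}" using w by auto
      then show ?thesis by simp
    qed
    have base: "\<exists>V\<in>\<B>. openin X V \<and> x \<in> V \<and> V \<subseteq> U" if U: "openin X U" "x \<in> U" for U x
    proof -
      obtain V where "V \<in> \<B>" "x \<in> V" "V \<subseteq> U"
        using \<B>(3)[OF U] by (elim bexE conjE)
      with \<B>(2)[of V] show ?thesis
        by (intro bexI[of _ V] conjI)
    qed
    have conv: "convergent (\<lambda>n. \<nu> (\<phi> (?w n) -` A))" if "A \<in> \<B>" for A
      using elim(2,3) that by simp
    obtain x where x: "x \<in> topspace X"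
      "\<And>U. openin X U \<Longrightarrow> x \<in> U \<Longrightarrow> \<forall>\<^sub>F n in sequentially. ?w n \<in> halo P U"
      using ex_limit_of_transient_path[OF w transient base conv P] by auto
    have "\<forall>\<^sub>F n in sequentially. ?w n \<in> A"
      if "openin X U" "x \<in> U" "finite (halo P U - A)" for U A
    proof -
      have "finite (\<Union>g\<in>halo P U - A. {n. ?w n = g})"
        using that(3) transient by blast
      then have "finite {n. ?w n \<in> halo P U - A}"
        by (rule rev_finite_subset) auto
      then have "\<forall>\<^sub>F n in sequentially. ?w n \<notin> halo P U - A"
        by (simp add: cofinite_eq_sequentially[symmetric] eventually_cofinite)
      with x(2)[OF that(1,2)] show ?thesis
        by eventually_elim auto
    qed
    with x(1) show ?case by blast
  qed
qed

section \<open>Glueing isolated points to a space\<close>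

text \<open>\<open>near U A\<close> is meant to say that almost all isolated points that are to be close to \<open>U\<close>
  belong to \<open>A\<close>.\<close>

locale glueing =
  fixes C :: "'g set" and X :: "'m topology" and near :: "'m set \<Rightarrow> 'g set \<Rightarrow> bool"
  assumes near_mono: "near U A \<Longrightarrow> A \<subseteq> B \<Longrightarrow> near U B"
    and near_Int: "near U A \<Longrightarrow> near V B \<Longrightarrow> near (U \<inter> V) (A \<inter> B)"
    and near_all: "near U C"
    and near_cofinite: "(\<And>x. x \<in> topspace X \<Longrightarrow> \<exists>U. openin X U \<and> x \<in> U \<and> near U A) \<Longrightarrow> finite (C - A)"
begin

text \<open>By \<open>near_Int\<close>, \<open>near_all\<close> and \<open>near_mono\<close> the set
  \<open>U\<close> can be replaced by a smaller open neighbourhood of \<open>x\<close>, so requiring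
  it to lie inside the trace of \<open>W\<close> would give the same open sets.\<close>

definition glued_open :: "('g + 'm) set \<Rightarrow> bool" where
  "glued_open W \<longleftrightarrow> W \<subseteq> C <+> topspace X \<and> openin X (Inr -` W) \<and>
    (\<forall>x. Inr x \<in> W \<longrightarrow> (\<exists>U. openin X U \<and> x \<in> U \<and> near U (Inl -` W)))"

lemma glued_openD: "glued_open W \<Longrightarrow> Inr x \<in> W \<Longrightarrow> \<exists>U. openin X U \<and> x \<in> U \<and> near U (Inl -` W)"
  by (simp add: glued_open_def)

definition glued :: "('g + 'm) topology" where
  "glued = topology glued_open"

lemma openin_glued: "openin glued = glued_open"
  unfolding glued_def
proof (rule topology_inverse')
  show "istopology glued_open"
    unfolding istopology_def
  proof (intro conjI allI impI)
    fix V W assume V: "glued_open V" and W: "glued_open W"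
    have "\<exists>U. openin X U \<and> x \<in> U \<and> near U (Inl -` (V \<inter> W))" if "Inr x \<in> V \<inter> W" for x
    proof -
      obtain U where "openin X U" "x \<in> U" "near U (Inl -` V)"
        using glued_openD[OF V] \<open>Inr x \<in> V \<inter> W\<close> by blast
      moreover obtain U' where "openin X U'" "x \<in> U'" "near U' (Inl -` W)"
        using glued_openD[OF W] \<open>Inr x \<in> V \<inter> W\<close> by blast
      ultimately show ?thesis
        using near_Int[of U "Inl -` V" U' "Inl -` W"] by (intro exI[of _ "U \<inter> U'"]) auto
    qed
    then show "glued_open (V \<inter> W)"
      using V W unfolding glued_open_def by auto
  next
    fix \<W> assume \<W>: "\<forall>W\<in>\<W>. glued_open W"
    have "\<exists>U. openin X U \<and> x \<in> U \<and> near U (Inl -` \<Union>\<W>)" if x: "Inr x \<in> W" "W \<in> \<W>" for x W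
    proof -
      obtain U where "openin X U" "x \<in> U" "near U (Inl -` W)"
        using \<W> glued_openD x by blast
      moreover have "Inl -` W \<subseteq> Inl -` \<Union>\<W>" using x by auto
      ultimately show ?thesis using near_mono by blast
    qed
    moreover have "openin X (\<Union>W\<in>\<W>. Inr -` W)"
      using \<W> by (intro openin_Union) (auto simp: glued_open_def)
    moreover have "\<Union>\<W> \<subseteq> C <+> topspace X"
      using \<W> unfolding glued_open_def by blast
    ultimately show "glued_open (\<Union>\<W>)"
      unfolding glued_open_def vimage_Union by blast
  qed
qed

lemma glued_open_isolated: "A \<subseteq> C \<Longrightarrow> glued_open (Inl ` A)"
proof -
  have "Inr -` Inl ` A = ({} :: 'm set)" by auto
  then show "A \<subseteq> C \<Longrightarrow> glued_open (Inl ` A)"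
    by (auto simp: glued_open_def)
qed

lemma glued_open_whole_fibre:
  assumes "openin X U" "near U A" "A \<subseteq> C"
  shows "glued_open (Inl ` A \<union> Inr ` U)"
proof -
  have "Inr -` (Inl ` A \<union> Inr ` U) = U" "Inl -` (Inl ` A \<union> Inr ` U) = A" by auto
  then show ?thesis
    using assms openin_subset[OF assms(1)] unfolding glued_open_def by auto
qed

lemma topspace_glued: "topspace glued = C <+> topspace X"
proof
  show "topspace glued \<subseteq> C <+> topspace X"
    using openin_topspace[of glued] by (simp add: openin_glued glued_open_def)
  have "openin glued (C <+> topspace X)"
    using glued_open_whole_fibre[OF openin_topspace near_all subset_refl] by (simp add: openin_glued Plus_def)
  then show "C <+> topspace X \<subseteq> topspace glued"
    by (rule openin_subset)
qed

lemma continuous_map_Inr: "continuous_map X glued Inr"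
proof -
  have "openin X {x \<in> topspace X. Inr x \<in> W}" if "openin glued W" for W
  proof -
    have W: "openin X (Inr -` W)"
      using that by (simp add: openin_glued glued_open_def)
    have "{x \<in> topspace X. Inr x \<in> W} = Inr -` W"
      using openin_subset[OF W] by (auto simp: subset_iff)
    with W show ?thesis by simp
  qed
  then show ?thesis
    by (simp add: continuous_map_def topspace_glued InrI)
qed

lemma embedding_map_Inl: "embedding_map (discrete_topology C) glued Inl"
proof (rule injective_open_imp_embedding_map)
  show "continuous_map (discrete_topology C) glued Inl"
    by (auto simp: topspace_glued)
  show "open_map (discrete_topology C) glued Inl"
    by (auto simp: open_map_def openin_glued glued_open_isolated)
qed auto

lemma embedding_map_Inr: "embedding_map X glued Inr"
  unfolding embedding_map_def
proof (rule bijective_open_imp_homeomorphic_map)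
  let ?S = "subtopology glued (Inr ` topspace X)"
  show "continuous_map X ?S Inr"
    by (simp add: continuous_map_in_subtopology continuous_map_Inr)
  show "open_map X ?S Inr"
    unfolding open_map_def
  proof (intro allI impI)
    fix U assume U: "openin X U"
    then have "openin glued (Inl ` C \<union> Inr ` U)"
      unfolding openin_glued by (intro glued_open_whole_fibre near_all) auto
    moreover have "Inr ` U = (Inl ` C \<union> Inr ` U) \<inter> Inr ` topspace X"
      using openin_subset[OF U] by auto
    ultimately show "openin ?S (Inr ` U)"
      unfolding openin_subtopology by blast
  qed
  show "Inr ` topspace X = topspace ?S"
    by (auto simp: topspace_glued)
qed auto

text \<open>Finitely many sets cover the copy of \<open>X\<close>. By \<open>near_cofinite\<close>
  they miss only finitely many isolated points, each of which costs one more set.\<close>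

lemma compact_space_glued:
  assumes "compact_space X"
  shows "compact_space glued"
  unfolding compact_space_def compactin_def
proof (intro conjI allI impI)
  fix \<W> assume \<W>: "(\<forall>W\<in>\<W>. openin glued W) \<and> topspace glued \<subseteq> \<Union>\<W>"
  have "compactin glued (Inr ` topspace X)"
    using assms by (intro image_compactin[OF _ continuous_map_Inr]) (simp add: compact_space_def)
  moreover have "Inr ` topspace X \<subseteq> \<Union>\<W>"
    using \<W> by (auto simp: topspace_glued)
  ultimately obtain \<F> where \<F>: "finite \<F>" "\<F> \<subseteq> \<W>" "Inr ` topspace X \<subseteq> \<Union>\<F>"
    using \<W> unfolding compactin_def by meson
  have "glued_open (\<Union>\<F>)"
    using \<W> \<F>(2) unfolding openin_glued[symmetric] by (intro openin_Union) auto
  then have fin: "finite (C - Inl -` \<Union>\<F>)"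
    using \<F>(3) by (intro near_cofinite glued_openD) auto
  have "\<forall>g\<in>C. \<exists>W\<in>\<W>. Inl g \<in> W"
    using \<W> by (auto simp: topspace_glued)
  then obtain c where c: "\<And>g. g \<in> C \<Longrightarrow> c g \<in> \<W> \<and> Inl g \<in> c g"
    by metis
  show "\<exists>\<F>. finite \<F> \<and> \<F> \<subseteq> \<W> \<and> topspace glued \<subseteq> \<Union>\<F>"
  proof (intro exI conjI)
    show "finite (\<F> \<union> c ` (C - Inl -` \<Union>\<F>))" using \<F>(1) fin by simp
    show "\<F> \<union> c ` (C - Inl -` \<Union>\<F>) \<subseteq> \<W>" using \<F>(2) c by auto
    show "topspace glued \<subseteq> \<Union>(\<F> \<union> c ` (C - Inl -` \<Union>\<F>))"
    proof
      fix z assume "z \<in> topspace glued"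
      then consider x where "z = Inr x" "x \<in> topspace X" | g where "z = Inl g" "g \<in> C"
        by (auto simp: topspace_glued)
      then show "z \<in> \<Union>(\<F> \<union> c ` (C - Inl -` \<Union>\<F>))"
      proof cases
        case 1
        then show ?thesis using \<F>(3) by auto
      next
        case 2
        then show ?thesis using c[of g] by (cases "Inl g \<in> \<Union>\<F>") auto
      qed
    qed
  qed
qed simp

lemma limitin_glued:
  assumes x: "x \<in> topspace X"
    and lim: "\<And>U A. openin X U \<Longrightarrow> x \<in> U \<Longrightarrow> near U A \<Longrightarrow> \<forall>\<^sub>F n in F. w n \<in> A"
  shows "limitin glued (\<lambda>n. Inl (w n)) (Inr x) F"
  unfolding limitin_def
proof (intro conjI allI impI)
  show "Inr x \<in> topspace glued" using x by (auto simp: topspace_glued)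
  fix W assume "openin glued W \<and> Inr x \<in> W"
  then obtain U where "openin X U" "x \<in> U" "near U (Inl -` W)"
    unfolding openin_glued glued_open_def by blast
  from lim[OF this] show "\<forall>\<^sub>F n in F. Inl (w n) \<in> W" by simp
qed

text \<open>The assumption \<open>singleton\<close> separates an isolated point from a point of
  \<open>X\<close>, and \<open>pair\<close> separates two points of \<open>X\<close>; two isolated
  points are open already.\<close>

lemma Hausdorff_space_glued:
  assumes singleton: "\<And>g x. x \<in> topspace X \<Longrightarrow> \<exists>U. openin X U \<and> x \<in> U \<and> near U (C - {g})"
    and pair: "\<And>x y. x \<in> topspace X \<Longrightarrow> y \<in> topspace X \<Longrightarrow> x \<noteq> y \<Longrightarrow>
      \<exists>U V A B. openin X U \<and> openin X V \<and> x \<in> U \<and> y \<in> V \<and> U \<inter> V = {} \<and>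
        near U A \<and> near V B \<and> A \<subseteq> C \<and> B \<subseteq> C \<and> A \<inter> B = {}"
  shows "Hausdorff_space glued"
proof -
  have isolated: "\<exists>V W. openin glued V \<and> openin glued W \<and> Inl g \<in> V \<and> z \<in> W \<and> disjnt V W"
    if g: "g \<in> C" and z: "z \<in> topspace glued" "z \<noteq> Inl g" for g z
  proof (cases z)
    case (Inl h)
    then have "h \<in> C" "h \<noteq> g" using z by (auto simp: topspace_glued)
    then show ?thesis
      using g Inl glued_open_isolated[of "{g}"] glued_open_isolated[of "{h}"]
      by (intro exI[of _ "Inl ` {g}"] exI[of _ "Inl ` {h}"]) (simp add: openin_glued)
  next
    case (Inr x)
    then have "x \<in> topspace X" using z by (auto simp: topspace_glued)
    then obtain U where U: "openin X U" "x \<in> U" "near U (C - {g})"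
      using singleton by blast
    have "glued_open (Inl ` (C - {g}) \<union> Inr ` U)"
      using U by (intro glued_open_whole_fibre) auto
    then show ?thesis
      using g U Inr glued_open_isolated[of "{g}"]
      by (intro exI[of _ "Inl ` {g}"] exI[of _ "Inl ` (C - {g}) \<union> Inr ` U"])
        (auto simp: openin_glued disjnt_def)
  qed
  show ?thesis
    unfolding Hausdorff_space_def
  proof (intro allI impI, elim conjE)
    fix y z assume yz: "y \<in> topspace glued" "z \<in> topspace glued" "y \<noteq> z"
    then consider g where "y = Inl g" "g \<in> C" | g where "z = Inl g" "g \<in> C"
      | x x' where "y = Inr x" "z = Inr x'" "x \<in> topspace X" "x' \<in> topspace X" "x \<noteq> x'"
      by (auto simp: topspace_glued)
    then show "\<exists>V W. openin glued V \<and> openin glued W \<and> y \<in> V \<and> z \<in> W \<and> disjnt V W"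
    proof cases
      case 1
      then show ?thesis using isolated[of g z] yz by auto
    next
      case 2
      then show ?thesis using isolated[of g y] yz by (metis disjnt_sym)
    next
      case 3
      then obtain U V A B where UV: "openin X U" "openin X V" "x \<in> U" "x' \<in> V" "U \<inter> V = {}"
        "near U A" "near V B" "A \<subseteq> C" "B \<subseteq> C" "A \<inter> B = {}"
        using pair by metis
      have "glued_open (Inl ` A \<union> Inr ` U)" "glued_open (Inl ` B \<union> Inr ` V)"
        using UV by (auto intro!: glued_open_whole_fibre)
      then show ?thesis
        using UV 3 by (intro exI[of _ "Inl ` A \<union> Inr ` U"] exI[of _ "Inl ` B \<union> Inr ` V"])
          (auto simp: openin_glued disjnt_def)
    qed
  qed
qed

end

section \<open>The compactification defined by halos\<close>

text \<open>The substantial axiom is \<open>near_cofinite\<close>: infinitely many elements outside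
  \<open>A\<close> would contain an attracting sequence of distinct elements, whose tail lies in a
  halo that \<open>A\<close> covers up to finitely many elements.\<close>

lemma (in minimal_convergence_group) glueing_halo:
  assumes P: "finite P" "P \<subseteq> topspace X"
  shows "glueing (carrier G) X (\<lambda>U A. finite (halo P U - A))"
proof
  show "finite (halo P U - B)" if "finite (halo P U - A)" "A \<subseteq> B" for U A B
    using that(1) by (rule rev_finite_subset) (use that(2) in auto)
  show "finite (halo P (U \<inter> V) - A \<inter> B)" if "finite (halo P U - A)" "finite (halo P V - B)" for U V A B
  proof -
    have "finite ((halo P U - A) \<union> (halo P V - B))" using that by simp
    then show ?thesis
      by (rule rev_finite_subset) (use halo_Int_subset in blast)
  qed
  show "finite (halo P U - carrier G)" for U
  proof -
    have "halo P U - carrier G = {}" by (auto simp: halo_def)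
    then show ?thesis by (simp only: finite.emptyI)
  qed
  show "finite (carrier G - A)"
    if near: "\<And>x. x \<in> topspace X \<Longrightarrow> \<exists>U. openin X U \<and> x \<in> U \<and> finite (halo P U - A)" for A
  proof (rule ccontr)
    assume "infinite (carrier G - A)"
    then obtain s :: "nat \<Rightarrow> 'g" where s: "inj s" "range s \<subseteq> carrier G - A"
      using infinite_countable_subset by blast
    then have sG: "range s \<subseteq> carrier G" by auto
    obtain r a b where r: "strict_mono r" "a \<in> topspace X" "b \<in> topspace X" "attracting (s \<circ> r) a b"
      by (rule ex_attracting[OF s(1) sG])
    obtain U where U: "openin X U" "b \<in> U" "finite (halo P U - A)"
      using near[OF r(3)] by blast
    have "\<forall>\<^sub>F k in sequentially. (s \<circ> r) k \<in> halo P U"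
      using sG by (intro attracting_halo[OF P _ r(4) U(1,2)]) auto
    then obtain N where N: "\<And>k. k \<ge> N \<Longrightarrow> s (r k) \<in> halo P U"
      by (auto simp: eventually_sequentially)
    have "(s \<circ> r) ` {N..} \<subseteq> halo P U - A" using N s(2) by auto
    then have "finite ((s \<circ> r) ` {N..})" using U(3) finite_subset by blast
    moreover have "inj (s \<circ> r)"
      using s(1) strict_mono_imp_inj_on[OF r(1)] by (intro comp_inj_on) (auto intro: inj_on_subset)
    then have "inj_on (s \<circ> r) {N..}" by (rule inj_on_subset) simp
    ultimately show False
      using infinite_Ici[of N] by (simp only: finite_image_iff)
  qed
qed

text \<open>Disjoint neighbourhoods \<open>U\<close> and \<open>V\<close> of two points are extended
  by their own halos, which \<open>halo_disjoint\<close> separates.\<close>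

lemma (in minimal_convergence_group) Hausdorff_halo:
  assumes P: "finite P" "P \<subseteq> topspace X" "card P = 3"
  shows "Hausdorff_space (glueing.glued (carrier G) X (\<lambda>U A. finite (halo P U - A)))"
proof -
  interpret glueing "carrier G" X "\<lambda>U A. finite (halo P U - A)"
    using P by (intro glueing_halo)
  show ?thesis
  proof (rule Hausdorff_space_glued)
    fix g x assume "x \<in> topspace X"
    moreover have "halo P (topspace X) - (carrier G - {g}) \<subseteq> {g}"
      by (auto simp: halo_def)
    then have "finite (halo P (topspace X) - (carrier G - {g}))"
      using finite_subset by blast
    ultimately show "\<exists>U. openin X U \<and> x \<in> U \<and> finite (halo P U - (carrier G - {g}))"
      by blast
  next
    fix x y assume "x \<in> topspace X" "y \<in> topspace X" "x \<noteq> y"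
    then obtain U V where UV: "openin X U" "openin X V" "x \<in> U" "y \<in> V" "U \<inter> V = {}"
      using hausdorff unfolding Hausdorff_space_def disjnt_def by metis
    have "halo P U \<subseteq> carrier G" "halo P V \<subseteq> carrier G" "finite (halo P U - halo P U)" "finite (halo P V - halo P V)"
      by (auto simp: halo_def)
    with UV halo_disjoint[OF P(3) UV(5)]
    show "\<exists>U V A B. openin X U \<and> openin X V \<and> x \<in> U \<and> y \<in> V \<and> U \<inter> V = {} \<and>
        finite (halo P U - A) \<and> finite (halo P V - B) \<and> A \<subseteq> carrier G \<and> B \<subseteq> carrier G \<and> A \<inter> B = {}"
      by meson
  qed
qed

theorem theorem1p1:
  fixes G :: "('g, 'b) monoid_scheme"
    and X :: "'m topology"
    and \<phi> :: "'g \<Rightarrow> 'm \<Rightarrow> 'm"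
  assumes "convergence_group G X \<phi>"
    and "topspace X \<noteq> {}"
    and "non_elementary G X \<phi>"
    and "minimal_action G X \<phi>"
  shows "\<exists>T :: ('g + 'm) topology.
    compactification_topology G X T \<and>
    (\<forall>\<mu> :: 'g pmf. generating_pmf G \<mu> \<longrightarrow>
      (AE \<omega> in increments \<mu>. \<exists>x\<in>topspace X.
        limitin T (\<lambda>n. Inl (random_walk G \<omega> n)) (Inr x) sequentially))"
proof -
  interpret convergence_group G X \<phi> by fact
  show ?thesis
  proof (cases "finite (carrier G)")
    case True
    \<comment> \<open>This relation ignores \<open>U\<close>: an open set meeting the space contains
      all of the group, so every walk in the group converges to every point of the space.\<close>
    interpret glueing "carrier G" X "\<lambda>U A. carrier G \<subseteq> A"
      using True by unfold_locales auto
    obtain x where x: "x \<in> topspace X" using assms(2) by blast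
    have "AE \<omega> in increments \<mu>. \<exists>x\<in>topspace X. limitin glued (\<lambda>n. Inl (random_walk G \<omega> n)) (Inr x) sequentially"
      if \<mu>: "generating_pmf G \<mu>" for \<mu>
      using AE_increments_in_support[of \<mu>]
    proof eventually_elim
      case (elim \<omega>)
      have "random_walk G \<omega> n \<in> carrier G" for n
        using elim \<mu> by (intro random_walk_closed) (auto simp: generating_pmf_def)
      then have "limitin glued (\<lambda>n. Inl (random_walk G \<omega> n)) (Inr x) sequentially"
        by (intro limitin_glued x always_eventually) auto
      then show ?case using x by blast
    qed
    moreover have "compactification_topology G X glued"
      unfolding compactification_topology_def
      using True compact_space
      by (simp add: topspace_glued compact_space_glued embedding_map_Inl embedding_map_Inr)
    ultimately show ?thesis by blast
  next
    case False
    interpret minimal_convergence_group G X \<phi>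
      by unfold_locales (use assms False in auto)
    \<comment> \<open>Any three points serve; they exist by \<open>infinite_space\<close> and are
      chosen before \<open>\<mu>\<close>, so one topology works for all generating measures.\<close>
    obtain P where P: "finite P" "card P = 3" "P \<subseteq> topspace X"
      using infinite_arbitrarily_large[OF infinite_space] by blast
    interpret glueing "carrier G" X "\<lambda>U A. finite (halo P U - A)"
      using P by (intro glueing_halo)
    have "AE \<omega> in increments \<mu>. \<exists>x\<in>topspace X. limitin glued (\<lambda>n. Inl (random_walk G \<omega> n)) (Inr x) sequentially"
      if \<mu>: "generating_pmf G \<mu>" for \<mu>
      using AE_random_walk_converges[OF \<mu> P(1,3)]
      by eventually_elim (blast intro: limitin_glued)
    moreover have "compactification_topology G X glued"
      unfolding compactification_topology_def
      using P compact_space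
      by (simp add: topspace_glued compact_space_glued embedding_map_Inl embedding_map_Inr Hausdorff_halo)
    ultimately show ?thesis by blast
  qed
qed

end
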